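(* Let $\mathcal X$ and $\mathcal Y$ be quantum sets. For every classical function $F$ from $\mathcal X$ to $\mathcal Y$, there is a unique ordinary function $f$ from $\mathrm{At}(\mathcal X)$ to $\mathrm{Fun}(\mathbf 1;\mathcal Y)$ such that $F=J\circ `f\circ Q$, where $Q$ is the canonical surjection from $\mathcal X$ to $`\mathrm{At}(\mathcal X)$, and $J$ is the canonical injection from $`\mathrm{Fun}(\mathbf 1;\mathcal Y)$ to $\mathcal Y$.
   Context: A quantum set $\mathcal X$ is determined by a set $\mathrm{At}(\mathcal X)$ of nonzero finite-dimensional complex Hilbert spaces, called its atoms; $X\propto\mathcal X$ means $X\in\mathrm{At}(\mathcal X)$. A binary relation $R$ from $\mathcal X$ to $\mathcal Y$ assigns to each $X\propto\mathcal X$, $Y\propto\mathcal Y$ a linear subspace $R(X,Y)\le L(X,Y)$ of the space of linear operators $X\to Y$. Composition: $(S\circ R)(X,Z)=\mathrm{span}\{sr : Y\propto\mathcal Y,\ s\in S(Y,Z),\ r\in R(X,Y)\}$. Identity: $I_{\mathcal X}(X,X)=\mathbb C\cdot 1_X$, $I_{\mathcal X}(X,X')=0$ for $X\ne X'$. Adjoint: $R^\dagger(Y,X)=\{r^\dagger: r\in R(X,Y)\}$. Order: $R\le S$ iff $R(X,Y)\le S(X,Y)$ for all $X,Y$. A function $F\colon\mathcal X\to\mathcal Y$ is a binary relation with $F^\dagger\circ F\ge I_{\mathcal X}$ and $F\circ F^\dagger\le I_{\mathcal Y}$; $\mathrm{Fun}(\mathcal X;\mathcal Y)$ is the set of functions.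 $\mathbf 1$ is the quantum set whose only atom is $\mathbb C$; it is terminal in the category of quantum sets and functions. For an ordinary set $S$, $`S$ is the quantum set with one one-dimensional atom $\mathbb C_a=\ell^2(\{a\})$ for each $a\in S$ (distinct for distinct $a$); an ordinary function $f\colon S\to S'$ gives $`f\colon`S\to`S'$ with $`f(\mathbb C_a,\mathbb C_{a'})=L(\mathbb C_a,\mathbb C_{a'})$ if $f(a)=a'$ and $0$ otherwise. $Q\colon\mathcal X\to`\mathrm{At}(\mathcal X)$ is defined by $Q(X,\mathbb C_X)=L(X,\mathbb C_X)$, the other components vanishing. For each function $G\colon\mathbf 1\to\mathcal Y$ there is a unique atom $Y_G\propto\mathcal Y$ with $G(\mathbb C,Y_G)\neq0$, it is one-dimensional, and $G\mapsto Y_G$ is a bijection onto the one-dimensional atoms of $\mathcal Y$; $J\colon`\mathrm{Fun}(\mathbf 1;\mathcal Y)\to\mathcal Y$ is defined by $J(\mathbb C_G,Y_G)=L(\mathbb C_G,Y_G)$, the other components vanishing. The Cartesian product $\mathcal Y_1\times\mathcal Y_2$ has atoms $Y_1\otimes Y_2$ for $Y_i\propto\mathcal Y_i$ (distinct pairs give distinct atoms), with $(R_1\times R_2)(X_1\otimes X_2,Y_1\otimes Y_2)=\mathrm{span}\{r_1\otimes r_2: r_i\in R_i(X_i,Y_i)\}$. The projection functions $P_1\colon\mathcal Y_1\times\mathcal Y_2\to\mathcal Y_1$ and $P_2\colon\mathcal Y_1\times\mathcal Y_2\to\mathcal Y_2$ are $I_{\mathcal Y_1}\times{!}$ and ${!}\times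 I_{\mathcal Y_2}$ followed by the canonical isomorphisms $\mathcal Y_1\times\mathbf 1\cong\mathcal Y_1$ and $\mathbf 1\times\mathcal Y_2\cong\mathcal Y_2$, where $!$ is the unique function to $\mathbf 1$. Functions $F_1\colon\mathcal X\to\mathcal Y_1$ and $F_2\colon\mathcal X\to\mathcal Y_2$ are compatible if there is a function $F\colon\mathcal X\to\mathcal Y_1\times\mathcal Y_2$ with $P_1\circ F=F_1$ and $P_2\circ F=F_2$. A function out of $\mathcal X$ is classical if it is compatible with the identity function $I_{\mathcal X}$. *)

theory Defs
  imports "Jordan_Normal_Form.VS_Connect" "HOL-Library.FuncSet"
begin

section \<open>Finite-dimensional Hilbert spaces\<close>

text \<open>
  Vector spaces are those of the AFP entry VectorSpace, over the ring record \<open>class_ring\<close> of the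
  type of complex numbers. They are modules in the sense of HOL-Algebra; the fields \<open>mult\<close> and
  \<open>one\<close> that HOL-Algebra modules inherit from rings carry no meaning.
\<close>

abbreviation complex_field :: "complex ring" where
  "complex_field \<equiv> class_ring"

record 'a hspace = "(complex, 'a) module" +
  inner :: "'a \<Rightarrow> 'a \<Rightarrow> complex"

text \<open>
  The inner product is linear in its second argument. Completeness is not assumed, because it is
  automatic in finite dimension.
\<close>

locale nonzero_fd_hilbert = vectorspace complex_field H for H :: "'a hspace" +
  assumes inner_add:
      "\<lbrakk>x \<in> carrier H; y \<in> carrier H; z \<in> carrier H\<rbrakk> \<Longrightarrow>
        inner H x (y \<oplus>\<^bsub>H\<^esub> z) = inner H x y + inner H x z"
    and inner_smult:
      "\<lbrakk>x \<in> carrier H; y \<in> carrier H\<rbrakk> \<Longrightarrow> inner H x (c \<odot>\<^bsub>H\<^esub> y) = c * inner H x y"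
    and inner_commute:
      "\<lbrakk>x \<in> carrier H; y \<in> carrier H\<rbrakk> \<Longrightarrow> inner H y x = cnj (inner H x y)"
    and inner_pos:
      "\<lbrakk>x \<in> carrier H; x \<noteq> \<zero>\<^bsub>H\<^esub>\<rbrakk> \<Longrightarrow> 0 < Re (inner H x x)"
    and finite_dimensional: "fin_dim"
    and nonzero: "carrier H \<noteq> {\<zero>\<^bsub>H\<^esub>}"

definition operators :: "'a hspace \<Rightarrow> 'b hspace \<Rightarrow> (complex, 'a \<Rightarrow> 'b) module" where
  "operators X Y =
    \<lparr>carrier = LinearCombinations.module_hom complex_field X Y \<inter> extensional (carrier X),
     mult = (\<lambda>r s. restrict (\<lambda>x. \<zero>\<^bsub>Y\<^esub>) (carrier X)),
     one = restrict (\<lambda>x. \<zero>\<^bsub>Y\<^esub>) (carrier X),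
     zero = restrict (\<lambda>x. \<zero>\<^bsub>Y\<^esub>) (carrier X),
     add = (\<lambda>r s. restrict (\<lambda>x. r x \<oplus>\<^bsub>Y\<^esub> s x) (carrier X)),
     smult = (\<lambda>c r. restrict (\<lambda>x. c \<odot>\<^bsub>Y\<^esub> r x) (carrier X))\<rparr>"

definition identity_operator :: "'a hspace \<Rightarrow> 'a \<Rightarrow> 'a" where
  "identity_operator X = restrict (\<lambda>x. x) (carrier X)"

definition adjoint :: "'a hspace \<Rightarrow> 'b hspace \<Rightarrow> ('a \<Rightarrow> 'b) \<Rightarrow> ('b \<Rightarrow> 'a)" where
  "adjoint X Y r =
    (THE s. s \<in> carrier (operators Y X) \<and>
      (\<forall>x\<in>carrier X. \<forall>y\<in>carrier Y. inner X (s y) x = inner Y y (r x)))"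

text \<open>The Hilbert space of complex numbers.\<close>

definition scalar_space :: "complex hspace" where
  "scalar_space =
    \<lparr>carrier = UNIV, mult = (\<lambda>x y. 0), one = 0, zero = 0, add = (+), smult = (*),
     inner = (\<lambda>x y. cnj x * y)\<rparr>"

text \<open>
  The Hilbert space of square-summable functions on \<open>{a}\<close>. The functions are undefined off
  \<open>{a}\<close>, so distinct elements \<open>a\<close> give distinct spaces.
\<close>

definition point_space :: "'s \<Rightarrow> ('s \<Rightarrow> complex) hspace" where
  "point_space a =
    \<lparr>carrier = {a} \<rightarrow>\<^sub>E UNIV,
     mult = (\<lambda>f g. restrict (\<lambda>b. 0) {a}),
     one = restrict (\<lambda>b. 0) {a},
     zero = restrict (\<lambda>b. 0) {a},
     add = (\<lambda>f g. restrict (\<lambda>b. f b + g b) {a}),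
     smult = (\<lambda>c f. restrict (\<lambda>b. c * f b) {a}),
     inner = (\<lambda>f g. cnj (f a) * g a)\<rparr>"


section \<open>Tensor products of Hilbert spaces\<close>

definition orthonormal_basis :: "'a hspace \<Rightarrow> 'a set \<Rightarrow> bool" where
  "orthonormal_basis X E \<longleftrightarrow>
    finite E \<and> E \<subseteq> carrier X \<and>
    (\<forall>e\<in>E. \<forall>e'\<in>E. inner X e e' = (if e = e' then 1 else 0)) \<and>
    LinearCombinations.module.span complex_field X E = carrier X"

definition some_onb :: "'a hspace \<Rightarrow> 'a set" where
  "some_onb X = (SOME E. orthonormal_basis X E)"

text \<open>Forms that are conjugate-linear in both arguments, extended by zero off the carriers.\<close>

definition conj_bilinear_forms :: "'a hspace \<Rightarrow> 'b hspace \<Rightarrow> ('a \<Rightarrow> 'b \<Rightarrow> complex) set" where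
  "conj_bilinear_forms X Y =
    {T. (\<forall>u\<in>carrier X. \<forall>u'\<in>carrier X. \<forall>v\<in>carrier Y. T (u \<oplus>\<^bsub>X\<^esub> u') v = T u v + T u' v) \<and>
        (\<forall>u\<in>carrier X. \<forall>v\<in>carrier Y. \<forall>v'\<in>carrier Y. T u (v \<oplus>\<^bsub>Y\<^esub> v') = T u v + T u v') \<and>
        (\<forall>c. \<forall>u\<in>carrier X. \<forall>v\<in>carrier Y. T (c \<odot>\<^bsub>X\<^esub> u) v = cnj c * T u v) \<and>
        (\<forall>c. \<forall>u\<in>carrier X. \<forall>v\<in>carrier Y. T u (c \<odot>\<^bsub>Y\<^esub> v) = cnj c * T u v) \<and>
        (\<forall>u v. u \<notin> carrier X \<or> v \<notin> carrier Y \<longrightarrow> T u v = 0)}"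

text \<open>
  The tensor product of \<open>X\<close> and \<open>Y\<close> is realised by conjugate-bilinear forms, with \<open>x \<otimes> y\<close> the
  form sending \<open>(u, v)\<close> to \<open>\<langle>u, x\<rangle> \<langle>v, y\<rangle>\<close>. The inner product does not depend on the choice of
  orthonormal bases, and \<open>\<langle>x \<otimes> y, x' \<otimes> y'\<rangle> = \<langle>x, x'\<rangle> \<langle>y, y'\<rangle>\<close>. Each vector is tagged with
  \<open>(X, Y)\<close>, so that distinct pairs of spaces have distinct tensor products.
\<close>

type_synonym ('a, 'b) tensor = "('a hspace \<times> 'b hspace) \<times> ('a \<Rightarrow> 'b \<Rightarrow> complex)"

definition tensor_space :: "'a hspace \<Rightarrow> 'b hspace \<Rightarrow> ('a, 'b) tensor hspace" where
  "tensor_space X Y =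
    \<lparr>carrier = {(X, Y)} \<times> conj_bilinear_forms X Y,
     mult = (\<lambda>s t. ((X, Y), \<lambda>u v. 0)),
     one = ((X, Y), \<lambda>u v. 0),
     zero = ((X, Y), \<lambda>u v. 0),
     add = (\<lambda>s t. ((X, Y), \<lambda>u v. snd s u v + snd t u v)),
     smult = (\<lambda>c t. ((X, Y), \<lambda>u v. c * snd t u v)),
     inner = (\<lambda>s t. \<Sum>e\<in>some_onb X. \<Sum>f\<in>some_onb Y. cnj (snd s e f) * snd t e f)\<rparr>"

definition tensor_vec :: "'a hspace \<Rightarrow> 'b hspace \<Rightarrow> 'a \<Rightarrow> 'b \<Rightarrow> ('a, 'b) tensor" where
  "tensor_vec X Y x y =
    ((X, Y), \<lambda>u v. if u \<in> carrier X \<and> v \<in> carrier Y then inner X u x * inner Y v y else 0)"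

definition tensor_op ::
  "'a hspace \<Rightarrow> 'b hspace \<Rightarrow> 'c hspace \<Rightarrow> 'd hspace \<Rightarrow> ('a \<Rightarrow> 'c) \<Rightarrow> ('b \<Rightarrow> 'd) \<Rightarrow>
    ('a, 'b) tensor \<Rightarrow> ('c, 'd) tensor" where
  "tensor_op X1 X2 Y1 Y2 r1 r2 =
    (THE t. t \<in> carrier (operators (tensor_space X1 X2) (tensor_space Y1 Y2)) \<and>
      (\<forall>x1\<in>carrier X1. \<forall>x2\<in>carrier X2.
        t (tensor_vec X1 X2 x1 x2) = tensor_vec Y1 Y2 (r1 x1) (r2 x2)))"

definition right_unit_op :: "'a hspace \<Rightarrow> ('a, complex) tensor \<Rightarrow> 'a" where
  "right_unit_op Y =
    (THE t. t \<in> carrier (operators (tensor_space Y scalar_space) Y) \<and>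
      (\<forall>y\<in>carrier Y. \<forall>c. t (tensor_vec Y scalar_space y c) = c \<odot>\<^bsub>Y\<^esub> y))"

definition left_unit_op :: "'a hspace \<Rightarrow> (complex, 'a) tensor \<Rightarrow> 'a" where
  "left_unit_op Y =
    (THE t. t \<in> carrier (operators (tensor_space scalar_space Y) Y) \<and>
      (\<forall>y\<in>carrier Y. \<forall>c. t (tensor_vec scalar_space Y c y) = c \<odot>\<^bsub>Y\<^esub> y))"


section \<open>Quantum sets, binary relations and functions\<close>

text \<open>
  A quantum set is identified with its set of atoms. Atoms are compared as records: isomorphic but
  distinct spaces are distinct atoms, and so are records that differ only in a field without
  meaning or in the values of an operation off the carrier.
\<close>

type_synonym 'a qset = "'a hspace set"

definition quantum_set :: "'a qset \<Rightarrow> bool" where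
  "quantum_set \<X> \<longleftrightarrow> (\<forall>X\<in>\<X>. nonzero_fd_hilbert X)"

text \<open>
  Components of a relation that do not belong to a pair of atoms are empty. Thus relations between
  given quantum sets are equal iff their components are, and the order of relations is the
  pointwise inclusion order \<open>\<le>\<close> on set-valued functions.
\<close>

type_synonym ('a, 'b) qrel = "'a hspace \<Rightarrow> 'b hspace \<Rightarrow> ('a \<Rightarrow> 'b) set"

definition binary_relations :: "'a qset \<Rightarrow> 'b qset \<Rightarrow> ('a, 'b) qrel set" where
  "binary_relations \<X> \<Y> =
    {R. (\<forall>X\<in>\<X>. \<forall>Y\<in>\<Y>. VectorSpace.subspace complex_field (R X Y) (operators X Y)) \<and>
        (\<forall>X Y. X \<notin> \<X> \<or> Y \<notin> \<Y> \<longrightarrow> R X Y = {})}"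

definition span_rel :: "'a qset \<Rightarrow> 'b qset \<Rightarrow> ('a, 'b) qrel \<Rightarrow> ('a, 'b) qrel" where
  "span_rel \<X> \<Y> B X Y =
    (if X \<in> \<X> \<and> Y \<in> \<Y> then LinearCombinations.module.span complex_field (operators X Y) (B X Y) else {})"

definition block_rel ::
  "'a qset \<Rightarrow> 'b qset \<Rightarrow> ('a hspace \<Rightarrow> 'b hspace \<Rightarrow> bool) \<Rightarrow> ('a, 'b) qrel" where
  "block_rel \<X> \<Y> P X Y =
    (if X \<in> \<X> \<and> Y \<in> \<Y>
     then if P X Y then carrier (operators X Y) else {\<zero>\<^bsub>operators X Y\<^esub>}
     else {})"

definition rel_comp ::
  "'a qset \<Rightarrow> 'b qset \<Rightarrow> 'c qset \<Rightarrow> ('b, 'c) qrel \<Rightarrow> ('a, 'b) qrel \<Rightarrow> ('a, 'c) qrel" where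
  "rel_comp \<X> \<Y> \<Z> S R =
    span_rel \<X> \<Z> (\<lambda>X Z. {compose (carrier X) s r | Y s r. Y \<in> \<Y> \<and> s \<in> S Y Z \<and> r \<in> R X Y})"

definition id_rel :: "'a qset \<Rightarrow> ('a, 'a) qrel" where
  "id_rel \<X> = span_rel \<X> \<X> (\<lambda>X X'. if X = X' then {identity_operator X} else {})"

definition dagger :: "('a, 'b) qrel \<Rightarrow> ('b, 'a) qrel" where
  "dagger R Y X = adjoint X Y ` R X Y"

definition Fun :: "'a qset \<Rightarrow> 'b qset \<Rightarrow> ('a, 'b) qrel set" where
  "Fun \<X> \<Y> =
    {F \<in> binary_relations \<X> \<Y>.
      id_rel \<X> \<le> rel_comp \<X> \<Y> \<X> (dagger F) F \<and>
      rel_comp \<Y> \<X> \<Y> F (dagger F) \<le> id_rel \<Y>}"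

definition one_qset :: "complex qset" where
  "one_qset = {scalar_space}"

definition terminal_map :: "'a qset \<Rightarrow> ('a, complex) qrel" where
  "terminal_map \<X> = (THE F. F \<in> Fun \<X> one_qset)"


section \<open>Ordinary sets as quantum sets\<close>

definition classical_qset :: "'s set \<Rightarrow> ('s \<Rightarrow> complex) qset" where
  "classical_qset S = point_space ` S"

definition classical_map ::
  "'s set \<Rightarrow> 't set \<Rightarrow> ('s \<Rightarrow> 't) \<Rightarrow> ('s \<Rightarrow> complex, 't \<Rightarrow> complex) qrel" where
  "classical_map S S' f =
    block_rel (classical_qset S) (classical_qset S')
      (\<lambda>A A'. \<exists>a\<in>S. A = point_space a \<and> A' = point_space (f a))"

definition canonical_surjection :: "'a qset \<Rightarrow> ('a, 'a hspace \<Rightarrow> complex) qrel" where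
  "canonical_surjection \<X> = block_rel \<X> (classical_qset \<X>) (\<lambda>X A. A = point_space X)"

definition point_atom :: "'b qset \<Rightarrow> (complex, 'b) qrel \<Rightarrow> 'b hspace" where
  "point_atom \<Y> G =
    (THE Y. Y \<in> \<Y> \<and> G scalar_space Y \<noteq> {\<zero>\<^bsub>operators scalar_space Y\<^esub>})"

definition canonical_injection :: "'b qset \<Rightarrow> ((complex, 'b) qrel \<Rightarrow> complex, 'b) qrel" where
  "canonical_injection \<Y> =
    block_rel (classical_qset (Fun one_qset \<Y>)) \<Y>
      (\<lambda>A Y. \<exists>G\<in>Fun one_qset \<Y>. A = point_space G \<and> Y = point_atom \<Y> G)"


section \<open>Cartesian products and classical functions\<close>

definition qset_prod :: "'a qset \<Rightarrow> 'b qset \<Rightarrow> ('a, 'b) tensor qset" where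
  "qset_prod \<X> \<Y> = {tensor_space X Y | X Y. X \<in> \<X> \<and> Y \<in> \<Y>}"

definition rel_prod ::
  "'a qset \<Rightarrow> 'b qset \<Rightarrow> 'c qset \<Rightarrow> 'd qset \<Rightarrow> ('a, 'c) qrel \<Rightarrow> ('b, 'd) qrel \<Rightarrow>
    (('a, 'b) tensor, ('c, 'd) tensor) qrel" where
  "rel_prod \<X>1 \<X>2 \<Y>1 \<Y>2 R1 R2 =
    span_rel (qset_prod \<X>1 \<X>2) (qset_prod \<Y>1 \<Y>2)
      (\<lambda>A B. {tensor_op X1 X2 Y1 Y2 r1 r2 | X1 X2 Y1 Y2 r1 r2.
        X1 \<in> \<X>1 \<and> X2 \<in> \<X>2 \<and> Y1 \<in> \<Y>1 \<and> Y2 \<in> \<Y>2 \<and>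
        A = tensor_space X1 X2 \<and> B = tensor_space Y1 Y2 \<and>
        r1 \<in> R1 X1 Y1 \<and> r2 \<in> R2 X2 Y2})"

definition right_unitor :: "'a qset \<Rightarrow> (('a, complex) tensor, 'a) qrel" where
  "right_unitor \<Y> =
    span_rel (qset_prod \<Y> one_qset) \<Y>
      (\<lambda>A Y. if A = tensor_space Y scalar_space then {right_unit_op Y} else {})"

definition left_unitor :: "'a qset \<Rightarrow> ((complex, 'a) tensor, 'a) qrel" where
  "left_unitor \<Y> =
    span_rel (qset_prod one_qset \<Y>) \<Y>
      (\<lambda>A Y. if A = tensor_space scalar_space Y then {left_unit_op Y} else {})"

definition proj1 :: "'a qset \<Rightarrow> 'b qset \<Rightarrow> (('a, 'b) tensor, 'a) qrel" where
  "proj1 \<Y>1 \<Y>2 =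
    rel_comp (qset_prod \<Y>1 \<Y>2) (qset_prod \<Y>1 one_qset) \<Y>1
      (right_unitor \<Y>1)
      (rel_prod \<Y>1 \<Y>2 \<Y>1 one_qset (id_rel \<Y>1) (terminal_map \<Y>2))"

definition proj2 :: "'a qset \<Rightarrow> 'b qset \<Rightarrow> (('a, 'b) tensor, 'b) qrel" where
  "proj2 \<Y>1 \<Y>2 =
    rel_comp (qset_prod \<Y>1 \<Y>2) (qset_prod one_qset \<Y>2) \<Y>2
      (left_unitor \<Y>2)
      (rel_prod \<Y>1 \<Y>2 one_qset \<Y>2 (terminal_map \<Y>1) (id_rel \<Y>2))"

definition compatible ::
  "'a qset \<Rightarrow> 'b qset \<Rightarrow> 'c qset \<Rightarrow> ('a, 'b) qrel \<Rightarrow> ('a, 'c) qrel \<Rightarrow> bool" where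
  "compatible \<X> \<Y>1 \<Y>2 F1 F2 \<longleftrightarrow>
    (\<exists>F\<in>Fun \<X> (qset_prod \<Y>1 \<Y>2).
      rel_comp \<X> (qset_prod \<Y>1 \<Y>2) \<Y>1 (proj1 \<Y>1 \<Y>2) F = F1 \<and>
      rel_comp \<X> (qset_prod \<Y>1 \<Y>2) \<Y>2 (proj2 \<Y>1 \<Y>2) F = F2)"

definition classical_Fun :: "'a qset \<Rightarrow> 'b qset \<Rightarrow> ('a, 'b) qrel set" where
  "classical_Fun \<X> \<Y> = {F \<in> Fun \<X> \<Y>. compatible \<X> \<Y> \<X> F (id_rel \<X>)}"

end

theory Submission
  imports Defs
begin

text \<open>
  Let \<open>K\<close> witness that \<open>F\<close> is compatible with the identity. A nonzero \<open>h \<in> K(X, Y \<otimes> X')\<close> exists, and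
  slicing it by functionals on \<open>Y\<close> yields elements of the identity relation; hence \<open>X' = X\<close> and
  \<open>h x = w \<otimes> x\<close> for some nonzero \<open>w \<in> Y\<close>. Slicing \<open>h\<close> by functionals on \<open>X\<close> instead shows that
  \<open>F(X, Y)\<close> contains \<open>|w\<rangle>\<langle>z|\<close> for every \<open>z \<in> X\<close>. Composing \<open>r \<in> F(X, Y')\<close> with the adjoints of these
  operators, \<open>F \<circ> F\<^sup>\<dagger> \<le> I\<close> forces \<open>r = 0\<close> if \<open>Y' \<noteq> Y\<close>, and forces \<open>Y\<close> to be spanned by \<open>w\<close>. So each atom
  \<open>X\<close> has exactly one \<open>Y\<close> with \<open>F(X, Y) \<noteq> 0\<close>; it is one-dimensional and \<open>F(X, Y) = L(X, Y)\<close>. The same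
  argument applied to \<open>Fun(1; \<Y>)\<close> identifies such \<open>Y\<close> with the points of \<open>\<Y>\<close>.
\<close>

section \<open>Complex vector spaces and Hilbert spaces\<close>

text \<open>Slicing has to pass through \<open>proj1\<close> and \<open>proj2\<close>, whose
  ingredients (\<open>adjoint\<close>, \<open>tensor_op\<close>, the unit operators,
  \<open>terminal_map\<close>) are definite descriptions. Each is first identified with a formula.
  As a tensor is a conjugate-bilinear form, r1 \<otimes> r2 is precomposition with the adjoints, a
  unit operator is evaluation at 1, and the function to \<open>one_qset\<close> has only full
  components. Hence every functional on one factor gives an element of the projection to the other,
  and a slice is the vector that represents a form with one argument fixed.

  The passage from components to the factorization rests on \<open>block_rel\<close>. A relation
  whose components are all zero or full behaves under composition and adjoint like the ordinary
  relation that says which components are full, because L(Y, Z) L(X, Y) spans L(X, Z) when Y is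
  nonzero. Q, J, the map induced by f, the points of \<Y> and finally F itself have this form, so
  existence and uniqueness of f become statements about predicates on atoms.\<close>

lemma vectorspace_complexI:
  fixes V :: "(complex, 'v, 'e) module_scheme"
  assumes "abelian_group V"
    and "\<And>a x. x \<in> carrier V \<Longrightarrow> a \<odot>\<^bsub>V\<^esub> x \<in> carrier V"
    and "\<And>a b x. x \<in> carrier V \<Longrightarrow> (a + b) \<odot>\<^bsub>V\<^esub> x = a \<odot>\<^bsub>V\<^esub> x \<oplus>\<^bsub>V\<^esub> b \<odot>\<^bsub>V\<^esub> x"
    and "\<And>a x y. \<lbrakk>x \<in> carrier V; y \<in> carrier V\<rbrakk> \<Longrightarrow>
      a \<odot>\<^bsub>V\<^esub> (x \<oplus>\<^bsub>V\<^esub> y) = a \<odot>\<^bsub>V\<^esub> x \<oplus>\<^bsub>V\<^esub> a \<odot>\<^bsub>V\<^esub> y"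
    and "\<And>a b x. x \<in> carrier V \<Longrightarrow> (a * b) \<odot>\<^bsub>V\<^esub> x = a \<odot>\<^bsub>V\<^esub> (b \<odot>\<^bsub>V\<^esub> x)"
    and "\<And>x. x \<in> carrier V \<Longrightarrow> 1 \<odot>\<^bsub>V\<^esub> x = x"
  shows "vectorspace complex_field V"
  unfolding vectorspace_def
  using assms by (auto intro!: moduleI class_cring.cring_axioms class_field)

text \<open>Scalars are arbitrary complex numbers with their ordinary + and *, free of carrier
  conditions. Having no inner product, the locale also covers the spaces of operators.\<close>

locale complex_space = vectorspace complex_field V for V :: "(complex, 'v, 'e) module_scheme"
begin

lemma scale_closed [simp, intro]: "x \<in> carrier V \<Longrightarrow> a \<odot>\<^bsub>V\<^esub> x \<in> carrier V"
  by (rule smult_closed) simp_all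

lemma scale_add_left: "x \<in> carrier V \<Longrightarrow> (a + b) \<odot>\<^bsub>V\<^esub> x = a \<odot>\<^bsub>V\<^esub> x \<oplus>\<^bsub>V\<^esub> b \<odot>\<^bsub>V\<^esub> x"
  using smult_l_distr[of a b x] by simp

lemma scale_add_right:
  "\<lbrakk>x \<in> carrier V; y \<in> carrier V\<rbrakk> \<Longrightarrow> a \<odot>\<^bsub>V\<^esub> (x \<oplus>\<^bsub>V\<^esub> y) = a \<odot>\<^bsub>V\<^esub> x \<oplus>\<^bsub>V\<^esub> a \<odot>\<^bsub>V\<^esub> y"
  using smult_r_distr[of a x y] by simp

lemma scale_scale: "x \<in> carrier V \<Longrightarrow> a \<odot>\<^bsub>V\<^esub> (b \<odot>\<^bsub>V\<^esub> x) = (a * b) \<odot>\<^bsub>V\<^esub> x"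
  using smult_assoc1[of a b x] by simp

lemma scale_one [simp]: "x \<in> carrier V \<Longrightarrow> 1 \<odot>\<^bsub>V\<^esub> x = x"
  using smult_one[of x] by simp

lemma scale_zero_left [simp]: "x \<in> carrier V \<Longrightarrow> 0 \<odot>\<^bsub>V\<^esub> x = \<zero>\<^bsub>V\<^esub>"
  using smult_l_null[of x] by simp

lemma scale_zero_right [simp]: "a \<odot>\<^bsub>V\<^esub> \<zero>\<^bsub>V\<^esub> = \<zero>\<^bsub>V\<^esub>"
  using smult_r_null[of a] by simp

lemma add_minus_self: "y \<in> carrier V \<Longrightarrow> y \<oplus>\<^bsub>V\<^esub> (-1) \<odot>\<^bsub>V\<^esub> y = \<zero>\<^bsub>V\<^esub>"
  using scale_add_left[of y 1 "-1"] by simp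

lemma minus_add_cancel:
  assumes "x \<in> carrier V" "y \<in> carrier V"
  shows "(x \<oplus>\<^bsub>V\<^esub> (-1) \<odot>\<^bsub>V\<^esub> y) \<oplus>\<^bsub>V\<^esub> y = x"
proof -
  have "(-1) \<odot>\<^bsub>V\<^esub> y \<oplus>\<^bsub>V\<^esub> y = \<zero>\<^bsub>V\<^esub>"
    using scale_add_left[of y "-1" 1] assms by simp
  then show ?thesis using assms by (simp add: M.add.m_assoc)
qed

lemma eq_if_minus_zero:
  assumes "x \<in> carrier V" "y \<in> carrier V" "x \<oplus>\<^bsub>V\<^esub> (-1) \<odot>\<^bsub>V\<^esub> y = \<zero>\<^bsub>V\<^esub>"
  shows "x = y"
  using minus_add_cancel[OF assms(1,2)] assms by simp

lemma scale_eq_zero_iff: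
  assumes "x \<in> carrier V"
  shows "a \<odot>\<^bsub>V\<^esub> x = \<zero>\<^bsub>V\<^esub> \<longleftrightarrow> a = 0 \<or> x = \<zero>\<^bsub>V\<^esub>"
proof -
  have "x = \<zero>\<^bsub>V\<^esub>" if "a \<odot>\<^bsub>V\<^esub> x = \<zero>\<^bsub>V\<^esub>" "a \<noteq> 0"
    using scale_scale[of x "inverse a" a] that assms by simp
  then show ?thesis using assms by auto
qed

lemma mem_span: "\<lbrakk>x \<in> S; x \<in> carrier V\<rbrakk> \<Longrightarrow> x \<in> span S"
  using in_own_span[of "{x}"] span_is_monotone[of "{x}" S] by auto

lemma submodule_iff:
  "submodule complex_field N V \<longleftrightarrow>
    N \<subseteq> carrier V \<and> \<zero>\<^bsub>V\<^esub> \<in> N \<and> (\<forall>x\<in>N. \<forall>y\<in>N. x \<oplus>\<^bsub>V\<^esub> y \<in> N) \<and> (\<forall>c. \<forall>x\<in>N. c \<odot>\<^bsub>V\<^esub> x \<in> N)"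
  using module_axioms by (auto simp: submodule_def)

lemma subspace_iff:
  "VectorSpace.subspace complex_field N V \<longleftrightarrow>
    N \<subseteq> carrier V \<and> \<zero>\<^bsub>V\<^esub> \<in> N \<and> (\<forall>x\<in>N. \<forall>y\<in>N. x \<oplus>\<^bsub>V\<^esub> y \<in> N) \<and> (\<forall>c. \<forall>x\<in>N. c \<odot>\<^bsub>V\<^esub> x \<in> N)"
  using vectorspace_axioms by (auto simp: VectorSpace.subspace_def submodule_iff)

text \<open>The induction step of the peeling arguments for operators and for tensors, where one
  rank-one or pure term is removed at a time.\<close>

lemma subspace_diffD:
  assumes "VectorSpace.subspace complex_field N V" "x \<in> carrier V"
    and "x \<oplus>\<^bsub>V\<^esub> (-1) \<odot>\<^bsub>V\<^esub> y \<in> N" "y \<in> N"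
  shows "x \<in> N"
  using assms minus_add_cancel[of x y] by (metis subspace_iff subsetD)

lemma subspace_span: "S \<subseteq> carrier V \<Longrightarrow> VectorSpace.subspace complex_field (span S) V"
  using span_is_submodule[of S] vectorspace_axioms by (simp add: VectorSpace.subspace_def)

lemma span_least: "\<lbrakk>S \<subseteq> N; VectorSpace.subspace complex_field N V\<rbrakk> \<Longrightarrow> span S \<subseteq> N"
  by (simp add: VectorSpace.subspace_def span_is_subset)

text \<open>The vectors with property P form a subspace containing S. This replaces the handling of
  explicit linear combinations.\<close>

lemma span_induct [consumes 2, case_names zero base add scale]:
  assumes "x \<in> span S" "S \<subseteq> carrier V"
    and "P \<zero>\<^bsub>V\<^esub>" "\<And>x. x \<in> S \<Longrightarrow> P x"
    and "\<And>x y. \<lbrakk>x \<in> carrier V; y \<in> carrier V; P x; P y\<rbrakk> \<Longrightarrow> P (x \<oplus>\<^bsub>V\<^esub> y)"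
    and "\<And>c x. \<lbrakk>x \<in> carrier V; P x\<rbrakk> \<Longrightarrow> P (c \<odot>\<^bsub>V\<^esub> x)"
  shows "P x"
proof -
  have "VectorSpace.subspace complex_field {x \<in> carrier V. P x} V"
    using assms by (auto simp: subspace_iff)
  then show ?thesis
    using assms span_least[of S "{x \<in> carrier V. P x}"] by auto
qed

end

lemma complex_spaceI: "vectorspace complex_field V \<Longrightarrow> complex_space V"
  by (simp add: complex_space_def)

sublocale nonzero_fd_hilbert \<subseteq> complex_space H
  by (rule complex_spaceI) (rule vectorspace_axioms)

lemma nonzero_fd_hilbert_complex_space: "nonzero_fd_hilbert X \<Longrightarrow> complex_space X"
  by (metis nonzero_fd_hilbert_def complex_spaceI)

section \<open>Orthonormal bases and the Riesz representation\<close>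

context nonzero_fd_hilbert begin

lemma inner_add_left:
  "\<lbrakk>x \<in> carrier H; y \<in> carrier H; z \<in> carrier H\<rbrakk> \<Longrightarrow>
    inner H (x \<oplus>\<^bsub>H\<^esub> y) z = inner H x z + inner H y z"
  by (metis M.add.m_closed complex_cnj_add inner_add inner_commute)

lemma inner_smult_left:
  "\<lbrakk>x \<in> carrier H; y \<in> carrier H\<rbrakk> \<Longrightarrow> inner H (c \<odot>\<^bsub>H\<^esub> x) y = cnj c * inner H x y"
  by (metis scale_closed complex_cnj_mult inner_smult inner_commute)

lemma inner_zero_right [simp]: "x \<in> carrier H \<Longrightarrow> inner H x \<zero>\<^bsub>H\<^esub> = 0"
  using inner_smult[of x "\<zero>\<^bsub>H\<^esub>" 0] by simp

lemma inner_zero_left [simp]: "x \<in> carrier H \<Longrightarrow> inner H \<zero>\<^bsub>H\<^esub> x = 0"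
  using inner_smult_left[of "\<zero>\<^bsub>H\<^esub>" x 0] by simp

lemma inner_self_eq_zero [simp]: "x \<in> carrier H \<Longrightarrow> inner H x x = 0 \<longleftrightarrow> x = \<zero>\<^bsub>H\<^esub>"
  by (metis inner_pos inner_zero_right less_irrefl zero_complex.sel(1))

lemma inner_self_real: "x \<in> carrier H \<Longrightarrow> inner H x x = of_real (Re (inner H x x))"
  using inner_commute[of x x] by (metis Reals_cnj_iff of_real_Re)

text \<open>The difference of the two vectors is orthogonal to itself. Adjoints and slices are
  vectors known only through their inner products, so their linearity is verified in this
  way.\<close>

lemma inner_ext:
  assumes "x \<in> carrier H" "y \<in> carrier H" "\<And>u. u \<in> carrier H \<Longrightarrow> inner H u x = inner H u y"
  shows "x = y"
proof (rule eq_if_minus_zero)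
  let ?d = "x \<oplus>\<^bsub>H\<^esub> (-1) \<odot>\<^bsub>H\<^esub> y"
  have "inner H ?d ?d = 0"
    using assms by (subst inner_add) (auto simp: inner_smult)
  then show "?d = \<zero>\<^bsub>H\<^esub>" using assms by simp
qed (use assms in auto)

lemma exists_nonzero: "\<exists>x\<in>carrier H. x \<noteq> \<zero>\<^bsub>H\<^esub>"
  using nonzero M.zero_closed by auto

text \<open>Unlike \<open>orthonormal_basis\<close>, this asks neither for finiteness nor for
  spanning, so that it can be maintained while a basis is built up.\<close>

definition orthonormal :: "'a set \<Rightarrow> bool" where
  "orthonormal E \<longleftrightarrow> E \<subseteq> carrier H \<and> (\<forall>e\<in>E. \<forall>e'\<in>E. inner H e e' = (if e = e' then 1 else 0))"

text \<open>Stands in for the sum of all \<open>g e\<close> times e, built one vector at a time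
  instead of as a finite sum in the module. It supplies both the projection in Gram-Schmidt and the
  representing vector in \<open>riesz\<close>.\<close>

lemma orthonormal_interpolate:
  assumes "finite E" "orthonormal E"
  shows "\<exists>z\<in>span E. \<forall>e\<in>E. inner H e z = g e"
  using assms
proof (induction E)
  case empty
  have "\<zero>\<^bsub>H\<^esub> \<in> span {}"
    using subspace_span[of "{}"] by (simp add: subspace_iff)
  then show ?case by auto
next
  case (insert a E)
  then obtain z where z: "z \<in> span E" "\<And>e. e \<in> E \<Longrightarrow> inner H e z = g e"
    by (auto simp: orthonormal_def)
  have E: "insert a E \<subseteq> carrier H" using insert.prems by (simp add: orthonormal_def)
  then have zc: "z \<in> carrier H" using z span_is_subset2[of E] by auto
  \<comment> \<open>Adding a multiple of a leaves the inner products with E unchanged. Subtracting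
    \<open>inner H a z\<close> makes the value at a correct without first showing that a is
    orthogonal to \<open>span E\<close>.\<close>
  define c where "c = g a - inner H a z"
  let ?z = "z \<oplus>\<^bsub>H\<^esub> c \<odot>\<^bsub>H\<^esub> a"
  have "?z \<in> span (insert a E)"
    using subspace_span[OF E] subsetD[OF span_is_monotone[OF subset_insertI] z(1), of a]
      mem_span[of a "insert a E"] E
    by (auto simp: subspace_iff)
  moreover have "inner H e ?z = g e" if "e \<in> insert a E" for e
    using that insert E zc z by (auto simp: inner_add inner_smult orthonormal_def c_def)
  ultimately show ?case by blast
qed

text \<open>Gram-Schmidt, as an induction over a possibly dependent family: a vector that already
  lies in the span leaves E as it is.\<close>

lemma orthonormal_exists:
  assumes "finite A" "A \<subseteq> carrier H"
  shows "\<exists>E. finite E \<and> orthonormal E \<and> A \<subseteq> span E"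
  using assms
proof (induction A)
  case empty
  then show ?case by (auto simp: orthonormal_def)
next
  case (insert a A)
  then obtain E where E: "finite E" "orthonormal E" "A \<subseteq> span E" by auto
  then have Ec: "E \<subseteq> carrier H" by (simp add: orthonormal_def)
  \<comment> \<open>p is the orthogonal projection of a to \<open>span E\<close>, characterised by
    its inner products with E; then d below is the orthogonal remainder.\<close>
  obtain p where p: "p \<in> span E" "\<And>e. e \<in> E \<Longrightarrow> inner H e p = inner H e a"
    using orthonormal_interpolate[OF E(1,2), of "\<lambda>e. inner H e a"] by auto
  have pc: "p \<in> carrier H" using p Ec span_is_subset2 by auto
  have ac: "a \<in> carrier H" using insert by auto
  define d where "d = a \<oplus>\<^bsub>H\<^esub> (-1) \<odot>\<^bsub>H\<^esub> p"
  have dc: "d \<in> carrier H" using ac pc by (simp add: d_def)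
  have ad: "a = d \<oplus>\<^bsub>H\<^esub> p" using minus_add_cancel[OF ac pc] by (simp add: d_def)
  show ?case
  proof (cases "d = \<zero>\<^bsub>H\<^esub>")
    case True
    then show ?thesis using ad p pc E by auto
  next
    case False
    define n where "n = sqrt (Re (inner H d d))"
    have n: "n > 0" using inner_pos[OF dc False] by (simp add: n_def)
    have nn: "inner H d d = of_real n * of_real n"
      using inner_self_real[OF dc] inner_pos[OF dc False]
      by (simp add: n_def flip: of_real_mult)
    define e0 where "e0 = complex_of_real (1 / n) \<odot>\<^bsub>H\<^esub> d"
    have e0c: "e0 \<in> carrier H" using dc by (simp add: e0_def)
    have d0: "d = of_real n \<odot>\<^bsub>H\<^esub> e0" using n dc by (simp add: e0_def scale_scale)
    have "inner H e d = 0" if "e \<in> E" for e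
      using that p(2)[OF that] Ec ac pc by (auto simp: d_def inner_add inner_smult)
    then have o1: "inner H e e0 = 0" if "e \<in> E" for e
      using that Ec dc by (auto simp: e0_def inner_smult)
    then have o2: "inner H e0 e = 0" if "e \<in> E" for e
      using that Ec e0c inner_commute[of e e0] by auto
    have o3: "inner H e0 e0 = 1"
      using n dc nn by (simp add: e0_def inner_smult inner_smult_left field_simps)
    have on: "orthonormal (insert e0 E)"
      using E(2) e0c o1 o2 o3 by (fastforce simp: orthonormal_def)
    have sub: "VectorSpace.subspace complex_field (span (insert e0 E)) H"
      using Ec e0c by (intro subspace_span) auto
    have mono: "span E \<subseteq> span (insert e0 E)" by (rule span_is_monotone) auto
    have "d \<in> span (insert e0 E)"
      using sub mem_span[of e0 "insert e0 E"] e0c by (simp add: d0 subspace_iff)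
    then have "a \<in> span (insert e0 E)"
      using sub p(1) mono by (auto simp: ad subspace_iff)
    then show ?thesis using on E mono by (intro exI[of _ "insert e0 E"]) auto
  qed
qed

lemma orthonormal_basis_exists: "\<exists>E. orthonormal_basis H E"
proof -
  obtain A where A: "finite A" "A \<subseteq> carrier H" "span A = carrier H"
    using finite_dimensional by (auto simp: fin_dim_def)
  then obtain E where E: "finite E" "orthonormal E" "A \<subseteq> span E"
    using orthonormal_exists by blast
  then have Ec: "E \<subseteq> carrier H" by (simp add: orthonormal_def)
  have "carrier H \<subseteq> span E"
    using span_least[OF E(3)] subspace_span[OF Ec] A by simp
  then have "span E = carrier H" using span_is_subset2[OF Ec] by auto
  then have "orthonormal_basis H E"
    using E(1,2) by (simp add: orthonormal_basis_def orthonormal_def)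
  then show ?thesis ..
qed

lemma orthonormal_basis_induct [consumes 2, case_names zero base add scale]:
  assumes "orthonormal_basis H E" "x \<in> carrier H"
    and "P \<zero>\<^bsub>H\<^esub>" "\<And>e. e \<in> E \<Longrightarrow> P e"
    and "\<And>x y. \<lbrakk>x \<in> carrier H; y \<in> carrier H; P x; P y\<rbrakk> \<Longrightarrow> P (x \<oplus>\<^bsub>H\<^esub> y)"
    and "\<And>c x. \<lbrakk>x \<in> carrier H; P x\<rbrakk> \<Longrightarrow> P (c \<odot>\<^bsub>H\<^esub> x)"
  shows "P x"
  using span_induct[of x E P] assms by (auto simp: orthonormal_basis_def)

text \<open>Phrased for conjugate-linear functionals because the inner product is conjugate-linear
  in its first argument, and because a conjugate-bilinear form with one argument fixed is such a
  functional. Interpolation settles the values on an orthonormal basis, and both sides extend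
  alike.\<close>

lemma riesz:
  assumes add: "\<And>x y. \<lbrakk>x \<in> carrier H; y \<in> carrier H\<rbrakk> \<Longrightarrow> \<phi> (x \<oplus>\<^bsub>H\<^esub> y) = \<phi> x + \<phi> y"
    and smult: "\<And>c x. x \<in> carrier H \<Longrightarrow> \<phi> (c \<odot>\<^bsub>H\<^esub> x) = cnj c * \<phi> x"
  shows "\<exists>z\<in>carrier H. \<forall>x\<in>carrier H. inner H x z = \<phi> x"
proof -
  obtain E where E: "orthonormal_basis H E" using orthonormal_basis_exists by blast
  then have Ec: "E \<subseteq> carrier H" by (simp add: orthonormal_basis_def)
  obtain z where z: "z \<in> span E" "\<And>e. e \<in> E \<Longrightarrow> inner H e z = \<phi> e"
    using orthonormal_interpolate[of E \<phi>] E by (auto simp: orthonormal_basis_def orthonormal_def)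
  then have zc: "z \<in> carrier H" using span_is_subset2[OF Ec] by auto
  have "inner H x z = \<phi> x" if "x \<in> carrier H" for x
    using E that
  proof (induction x rule: orthonormal_basis_induct)
    case zero
    show ?case using smult[of "\<zero>\<^bsub>H\<^esub>" 0] zc by simp
  qed (use z zc add smult in \<open>auto simp: inner_add_left inner_smult_left\<close>)
  then show ?thesis using zc by blast
qed

end

section \<open>Spaces of operators\<close>

lemma operators_iff:
  "r \<in> carrier (operators X Y) \<longleftrightarrow>
    r \<in> extensional (carrier X) \<and>
    (\<forall>x\<in>carrier X. r x \<in> carrier Y) \<and>
    (\<forall>x\<in>carrier X. \<forall>x'\<in>carrier X. r (x \<oplus>\<^bsub>X\<^esub> x') = r x \<oplus>\<^bsub>Y\<^esub> r x') \<and>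
    (\<forall>c. \<forall>x\<in>carrier X. r (c \<odot>\<^bsub>X\<^esub> x) = c \<odot>\<^bsub>Y\<^esub> r x)"
  by (auto simp: operators_def LinearCombinations.module_hom_def)

lemma operators_simps [simp]:
  "\<zero>\<^bsub>operators X Y\<^esub> = restrict (\<lambda>x. \<zero>\<^bsub>Y\<^esub>) (carrier X)"
  "r \<oplus>\<^bsub>operators X Y\<^esub> s = restrict (\<lambda>x. r x \<oplus>\<^bsub>Y\<^esub> s x) (carrier X)"
  "c \<odot>\<^bsub>operators X Y\<^esub> r = restrict (\<lambda>x. c \<odot>\<^bsub>Y\<^esub> r x) (carrier X)"
  by (simp_all add: operators_def)

lemma operators_closed: "\<lbrakk>r \<in> carrier (operators X Y); x \<in> carrier X\<rbrakk> \<Longrightarrow> r x \<in> carrier Y"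
  and operators_add: "\<lbrakk>r \<in> carrier (operators X Y); x \<in> carrier X; x' \<in> carrier X\<rbrakk> \<Longrightarrow>
    r (x \<oplus>\<^bsub>X\<^esub> x') = r x \<oplus>\<^bsub>Y\<^esub> r x'"
  and operators_scale: "\<lbrakk>r \<in> carrier (operators X Y); x \<in> carrier X\<rbrakk> \<Longrightarrow>
    r (c \<odot>\<^bsub>X\<^esub> x) = c \<odot>\<^bsub>Y\<^esub> r x"
  by (simp_all add: operators_iff)

lemma operators_ext:
  "\<lbrakk>r \<in> carrier (operators X Y); s \<in> carrier (operators X Y);
    \<And>x. x \<in> carrier X \<Longrightarrow> r x = s x\<rbrakk> \<Longrightarrow> r = s"
  by (auto simp: operators_iff intro: extensionalityI)

lemma operators_zero:
  assumes "complex_space X" "complex_space Y" "r \<in> carrier (operators X Y)"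
  shows "r \<zero>\<^bsub>X\<^esub> = \<zero>\<^bsub>Y\<^esub>"
proof -
  interpret X: complex_space X by fact
  interpret Y: complex_space Y by fact
  show ?thesis
    using operators_scale[OF assms(3), of "\<zero>\<^bsub>X\<^esub>" 0] operators_closed[OF assms(3)] by simp
qed

lemma complex_space_operators:
  assumes "complex_space X" "complex_space Y"
  shows "complex_space (operators X Y)"
proof -
  interpret X: complex_space X by fact
  interpret Y: complex_space Y by fact
  have "abelian_group (operators X Y)"
  proof (rule abelian_groupI)
    fix r assume r: "r \<in> carrier (operators X Y)"
    have "(-1) \<odot>\<^bsub>operators X Y\<^esub> r \<in> carrier (operators X Y)"
      using r by (simp add: operators_iff Y.scale_add_right Y.scale_scale mult.commute)
    moreover have "(-1) \<odot>\<^bsub>operators X Y\<^esub> r \<oplus>\<^bsub>operators X Y\<^esub> r = \<zero>\<^bsub>operators X Y\<^esub>"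
      using r Y.scale_add_left[of _ "-1" 1] by (auto simp: operators_iff fun_eq_iff)
    ultimately show "\<exists>s\<in>carrier (operators X Y). s \<oplus>\<^bsub>operators X Y\<^esub> r = \<zero>\<^bsub>operators X Y\<^esub>"
      by blast
  next
    fix r s assume "r \<in> carrier (operators X Y)" "s \<in> carrier (operators X Y)"
    then show "r \<oplus>\<^bsub>operators X Y\<^esub> s \<in> carrier (operators X Y)"
      by (auto simp: operators_iff Y.scale_add_right Y.M.add.m_ac Y.M.add.m_closed)
  next
    fix r assume "r \<in> carrier (operators X Y)"
    then show "\<zero>\<^bsub>operators X Y\<^esub> \<oplus>\<^bsub>operators X Y\<^esub> r = r"
      by (auto simp: operators_iff extensional_def fun_eq_iff)
  qed (auto simp: operators_iff Y.M.add.m_ac fun_eq_iff)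
  then show ?thesis
    by (intro complex_spaceI vectorspace_complexI)
      (auto simp: operators_iff fun_eq_iff Y.scale_add_left Y.scale_add_right Y.scale_scale
        mult.commute extensional_def)
qed

lemma compose_operators:
  "\<lbrakk>complex_space X; s \<in> carrier (operators Y Z); r \<in> carrier (operators X Y)\<rbrakk> \<Longrightarrow>
    compose (carrier X) s r \<in> carrier (operators X Z)"
proof -
  assume "complex_space X"
  then interpret X: complex_space X .
  assume "s \<in> carrier (operators Y Z)" "r \<in> carrier (operators X Y)"
  then show ?thesis by (auto simp: operators_iff compose_def)
qed

lemma identity_operator_operators: "complex_space X \<Longrightarrow> identity_operator X \<in> carrier (operators X X)"
proof -
  assume "complex_space X"
  then interpret X: complex_space X .
  show ?thesis by (auto simp: operators_iff identity_operator_def)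
qed

section \<open>Adjoints and rank-one operators\<close>

lemma adjoint_unique:
  assumes "nonzero_fd_hilbert X"
    and "s \<in> carrier (operators Y X)" "s' \<in> carrier (operators Y X)"
    and "\<And>x y. \<lbrakk>x \<in> carrier X; y \<in> carrier Y\<rbrakk> \<Longrightarrow> inner X (s y) x = inner X (s' y) x"
  shows "s = s'"
proof (rule operators_ext[OF assms(2,3)])
  interpret X: nonzero_fd_hilbert X by fact
  fix y assume y: "y \<in> carrier Y"
  then have c: "s y \<in> carrier X" "s' y \<in> carrier X"
    using assms(2,3) operators_closed by metis+
  show "s y = s' y"
    using c assms(4)[OF _ y] X.inner_commute by (intro X.inner_ext) metis+
qed

lemma adjoint_eqI:
  assumes "nonzero_fd_hilbert X" "s \<in> carrier (operators Y X)"
    and "\<And>x y. \<lbrakk>x \<in> carrier X; y \<in> carrier Y\<rbrakk> \<Longrightarrow> inner X (s y) x = inner Y y (r x)"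
  shows "adjoint X Y r = s"
  unfolding adjoint_def
  using assms by (intro the_equality) (auto intro!: adjoint_unique[of X _ Y s])

text \<open>For fixed y, the Riesz vector of x \<mapsto> <r x, y> is the value of the adjoint at y.
  Linearity in y follows from \<open>inner_ext\<close>.\<close>

lemma
  assumes "nonzero_fd_hilbert X" "nonzero_fd_hilbert Y" "r \<in> carrier (operators X Y)"
  shows adjoint_operators: "adjoint X Y r \<in> carrier (operators Y X)" (is ?A)
    and inner_adjoint_left: "\<And>x y. \<lbrakk>x \<in> carrier X; y \<in> carrier Y\<rbrakk> \<Longrightarrow>
      inner X (adjoint X Y r y) x = inner Y y (r x)" (is "PROP ?B")
proof -
  interpret X: nonzero_fd_hilbert X by fact
  interpret Y: nonzero_fd_hilbert Y by fact
  note r = operators_closed[OF assms(3)] operators_add[OF assms(3)] operators_scale[OF assms(3)]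
  have "\<exists>z\<in>carrier X. \<forall>x\<in>carrier X. inner X x z = inner Y (r x) y" if "y \<in> carrier Y" for y
    using that r by (intro X.riesz) (auto simp: Y.inner_add_left Y.inner_smult_left)
  then obtain t where t: "\<And>y. y \<in> carrier Y \<Longrightarrow> t y \<in> carrier X"
    "\<And>x y. \<lbrakk>x \<in> carrier X; y \<in> carrier Y\<rbrakk> \<Longrightarrow> inner X x (t y) = inner Y (r x) y"
    by metis
  let ?s = "restrict t (carrier Y)"
  have "t (y \<oplus>\<^bsub>Y\<^esub> y') = t y \<oplus>\<^bsub>X\<^esub> t y'" if "y \<in> carrier Y" "y' \<in> carrier Y" for y y'
    using that t r by (intro X.inner_ext) (auto simp: X.inner_add Y.inner_add)
  moreover have "t (c \<odot>\<^bsub>Y\<^esub> y) = c \<odot>\<^bsub>X\<^esub> t y" if "y \<in> carrier Y" for c y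
    using that t r by (intro X.inner_ext) (auto simp: X.inner_smult Y.inner_smult)
  ultimately have s: "?s \<in> carrier (operators Y X)"
    using t(1) by (auto simp: operators_iff)
  have eq: "inner X (?s y) x = inner Y y (r x)" if "x \<in> carrier X" "y \<in> carrier Y" for x y
    using that t r X.inner_commute Y.inner_commute by (metis restrict_apply')
  have "adjoint X Y r = ?s"
    using assms s eq by (intro adjoint_eqI) auto
  then show ?A "PROP ?B" using s eq by auto
qed

lemma inner_adjoint_right:
  assumes "nonzero_fd_hilbert X" "nonzero_fd_hilbert Y" "r \<in> carrier (operators X Y)"
    and "x \<in> carrier X" "y \<in> carrier Y"
  shows "inner X x (adjoint X Y r y) = inner Y (r x) y"
proof -
  interpret X: nonzero_fd_hilbert X by fact
  interpret Y: nonzero_fd_hilbert Y by fact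
  show ?thesis
    using inner_adjoint_left[OF assms] adjoint_operators[OF assms(1-3)] assms
      operators_closed X.inner_commute Y.inner_commute by metis
qed

lemma adjoint_adjoint:
  assumes "nonzero_fd_hilbert X" "nonzero_fd_hilbert Y" "r \<in> carrier (operators X Y)"
  shows "adjoint Y X (adjoint X Y r) = r"
  using assms by (intro adjoint_eqI) (auto simp: inner_adjoint_right)

text \<open>Surjectivity comes from the adjoint being an involution. This makes the dagger of a full
  component full.\<close>

lemma adjoint_image_operators:
  assumes "nonzero_fd_hilbert X" "nonzero_fd_hilbert Y"
  shows "adjoint X Y ` carrier (operators X Y) = carrier (operators Y X)"
proof (intro equalityI subsetI)
  fix s assume s: "s \<in> carrier (operators Y X)"
  then have "s = adjoint X Y (adjoint Y X s)" using assms by (simp add: adjoint_adjoint)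
  then show "s \<in> adjoint X Y ` carrier (operators X Y)" using s assms adjoint_operators by blast
qed (use assms adjoint_operators in blast)

lemma adjoint_zero:
  assumes "nonzero_fd_hilbert X" "nonzero_fd_hilbert Y"
  shows "adjoint X Y \<zero>\<^bsub>operators X Y\<^esub> = \<zero>\<^bsub>operators Y X\<^esub>"
proof -
  interpret X: nonzero_fd_hilbert X by fact
  interpret Y: nonzero_fd_hilbert Y by fact
  show ?thesis
    using assms by (intro adjoint_eqI) (auto simp: operators_iff)
qed

text \<open>The operator |w><z|, with the vector of the target space first.\<close>

definition rank_one :: "'a hspace \<Rightarrow> 'b hspace \<Rightarrow> 'b \<Rightarrow> 'a \<Rightarrow> 'a \<Rightarrow> 'b" where
  "rank_one X Y w z = restrict (\<lambda>x. inner X z x \<odot>\<^bsub>Y\<^esub> w) (carrier X)"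

lemma rank_one_operators:
  assumes "nonzero_fd_hilbert X" "complex_space Y" "w \<in> carrier Y" "z \<in> carrier X"
  shows "rank_one X Y w z \<in> carrier (operators X Y)"
proof -
  interpret X: nonzero_fd_hilbert X by fact
  interpret Y: complex_space Y by fact
  show ?thesis
    using assms by (auto simp: operators_iff rank_one_def X.inner_add X.inner_smult
        Y.scale_add_left Y.scale_scale)
qed

lemma adjoint_rank_one:
  assumes "nonzero_fd_hilbert X" "nonzero_fd_hilbert Y" "w \<in> carrier Y" "z \<in> carrier X"
  shows "adjoint X Y (rank_one X Y w z) = rank_one Y X z w"
proof -
  interpret X: nonzero_fd_hilbert X by fact
  interpret Y: nonzero_fd_hilbert Y by fact
  have "inner X (inner Y w y \<odot>\<^bsub>X\<^esub> z) x = inner Y y (inner X z x \<odot>\<^bsub>Y\<^esub> w)"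
    if "x \<in> carrier X" "y \<in> carrier Y" for x y
    using that assms Y.inner_commute[of w y] by (simp add: X.inner_smult_left Y.inner_smult)
  then show ?thesis
    using assms by (intro adjoint_eqI rank_one_operators)
      (auto simp: rank_one_def Y.complex_space_axioms X.complex_space_axioms)
qed

lemma compose_rank_one:
  assumes "nonzero_fd_hilbert X" "complex_space Y" "s \<in> carrier (operators Y Z)"
    and "w \<in> carrier Y" "z \<in> carrier X"
  shows "compose (carrier X) s (rank_one X Y w z) = rank_one X Z (s w) z"
  using assms operators_scale[OF assms(3)] by (auto simp: compose_def rank_one_def fun_eq_iff)

lemma rank_one_eq_zero:
  assumes "nonzero_fd_hilbert X" "complex_space Y" "w \<in> carrier Y" "z \<in> carrier X"
    and "rank_one X Y w z = \<zero>\<^bsub>operators X Y\<^esub>"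
  shows "w = \<zero>\<^bsub>Y\<^esub> \<or> z = \<zero>\<^bsub>X\<^esub>"
proof -
  interpret X: nonzero_fd_hilbert X by fact
  interpret Y: complex_space Y by fact
  have "inner X z z \<odot>\<^bsub>Y\<^esub> w = \<zero>\<^bsub>Y\<^esub>"
    using fun_cong[OF assms(5), of z] assms(4) by (simp add: rank_one_def)
  then show ?thesis using assms by (auto simp: Y.scale_eq_zero_iff)
qed

lemma operators_nonzero:
  assumes "nonzero_fd_hilbert X" "nonzero_fd_hilbert Y"
  shows "carrier (operators X Y) \<noteq> {\<zero>\<^bsub>operators X Y\<^esub>}"
proof -
  interpret X: nonzero_fd_hilbert X by fact
  interpret Y: nonzero_fd_hilbert Y by fact
  obtain x y where "x \<in> carrier X" "x \<noteq> \<zero>\<^bsub>X\<^esub>" "y \<in> carrier Y" "y \<noteq> \<zero>\<^bsub>Y\<^esub>"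
    using X.exists_nonzero Y.exists_nonzero by blast
  then show ?thesis
    using rank_one_operators[of X Y y x] rank_one_eq_zero[of X Y y x] assms(1) Y.complex_space_axioms
    by auto
qed

text \<open>An operator is reduced to zero by subtracting \<open>|r a\<rangle>\<langle>a|\<close> for the elements \<open>a\<close> of an orthonormal
  basis one at a time, which avoids sums in the module of operators.\<close>

lemma subspace_contains_rank_one:
  assumes "nonzero_fd_hilbert X" "complex_space Y"
    and N: "VectorSpace.subspace complex_field N (operators X Y)"
    and rank1: "\<And>w z. \<lbrakk>w \<in> carrier Y; z \<in> carrier X\<rbrakk> \<Longrightarrow> rank_one X Y w z \<in> N"
  shows "N = carrier (operators X Y)"
proof -
  interpret X: nonzero_fd_hilbert X by fact
  interpret Y: complex_space Y by fact
  interpret L: complex_space "operators X Y"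
    by (rule complex_space_operators) (fact X.complex_space_axioms, fact)
  obtain E where E: "orthonormal_basis X E" using X.orthonormal_basis_exists by blast
  then have Ec: "E \<subseteq> carrier X" "finite E" by (auto simp: orthonormal_basis_def)
  \<comment> \<open>A contains the basis vectors at which r is still allowed to be nonzero; for A =
    E this is no restriction.\<close>
  have "r \<in> N" if "A \<subseteq> E" "r \<in> carrier (operators X Y)" "\<And>e. e \<in> E - A \<Longrightarrow> r e = \<zero>\<^bsub>Y\<^esub>" for A r
    using finite_subset[OF that(1) Ec(2)] that
  proof (induction A arbitrary: r)
    case empty
    have "r x = \<zero>\<^bsub>Y\<^esub>" if "x \<in> carrier X" for x
      using E that
      by (induction x rule: X.orthonormal_basis_induct)
        (use empty in \<open>auto simp: operators_add operators_scale
          operators_zero[OF X.complex_space_axioms Y.complex_space_axioms]\<close>)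
    then have "r = \<zero>\<^bsub>operators X Y\<^esub>"
      using empty by (intro operators_ext[of _ X Y]) (auto intro: L.M.zero_closed simp del: operators_simps, simp)
    then show ?case using N by (simp add: L.subspace_iff del: operators_simps)
  next
    case (insert a A)
    have a: "a \<in> carrier X" "r a \<in> carrier Y"
      using insert.prems(1) Ec operators_closed[OF insert.prems(2), of a] by auto
    let ?k = "rank_one X Y (r a) a"
    let ?r' = "r \<oplus>\<^bsub>operators X Y\<^esub> (-1) \<odot>\<^bsub>operators X Y\<^esub> ?k"
    have k: "?k \<in> carrier (operators X Y)" using a assms by (intro rank_one_operators)
    have r: "r \<in> carrier (operators X Y)" by fact
    have "?r' \<in> N"
    proof (rule insert.IH)
      show "?r' \<in> carrier (operators X Y)" using r k by (intro L.M.add.m_closed L.scale_closed)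
      fix e assume e: "e \<in> E - A"
      then have ec: "e \<in> carrier X" using Ec by auto
      show "?r' e = \<zero>\<^bsub>Y\<^esub>"
      proof (cases "e = a")
        case True
        then have "inner X a e = 1" using E e by (auto simp: orthonormal_basis_def)
        then show ?thesis using True a by (simp add: rank_one_def Y.add_minus_self)
      next
        case False
        then have "inner X a e = 0" "r e = \<zero>\<^bsub>Y\<^esub>"
          using E e insert.prems by (auto simp: orthonormal_basis_def)
        then show ?thesis using a ec by (simp add: rank_one_def)
      qed
    qed (use insert.prems in auto)
    then show ?case using rank1[OF a(2,1)] by (rule L.subspace_diffD[OF N r])
  qed
  from this[of E] show ?thesis using N by (auto simp: L.subspace_iff)
qed

section \<open>Scalars, points and tensor products\<close>

lemma (in complex_space) fin_dim_if_one_generator: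
  assumes "w \<in> carrier V" "\<And>x. x \<in> carrier V \<Longrightarrow> \<exists>c. x = c \<odot>\<^bsub>V\<^esub> w"
  shows "fin_dim"
proof -
  have "x \<in> span {w}" if "x \<in> carrier V" for x
    using assms(2)[OF that] subspace_span[of "{w}"] mem_span[of w "{w}"] assms(1)
    by (auto simp: subspace_iff)
  then have "span {w} = carrier V"
    using span_is_subset2[of "{w}"] assms(1) by auto
  then show ?thesis using assms(1) by (auto simp: fin_dim_def intro!: exI[of _ "{w}"])
qed

lemma scalar_space_simps [simp]:
  "carrier scalar_space = UNIV" "x \<oplus>\<^bsub>scalar_space\<^esub> y = x + y" "\<zero>\<^bsub>scalar_space\<^esub> = 0"
  "c \<odot>\<^bsub>scalar_space\<^esub> x = c * x" "inner scalar_space x y = cnj x * y"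
  by (simp_all add: scalar_space_def)

lemma nonzero_fd_hilbert_scalar_space: "nonzero_fd_hilbert scalar_space"
proof -
  have "abelian_group scalar_space"
    by (rule abelian_groupI) (auto intro: exI[of _ "- x" for x])
  then have V: "vectorspace complex_field scalar_space"
    by (rule vectorspace_complexI) (auto simp: algebra_simps)
  interpret complex_space scalar_space by (rule complex_spaceI[OF V])
  have "fin_dim" by (rule fin_dim_if_one_generator[of 1]) auto
  moreover have "(UNIV :: complex set) \<noteq> {0}" by (metis UNIV_I one_neq_zero singletonD)
  ultimately show ?thesis
    using V by (intro nonzero_fd_hilbert.intro nonzero_fd_hilbert_axioms.intro)
      (auto simp: algebra_simps complex_eq_iff sum_power2_gt_zero_iff simp flip: power2_eq_square)
qed

lemma point_space_simps [simp]:
  "carrier (point_space a) = {a} \<rightarrow>\<^sub>E UNIV"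
  "f \<oplus>\<^bsub>point_space a\<^esub> g = restrict (\<lambda>b. f b + g b) {a}"
  "\<zero>\<^bsub>point_space a\<^esub> = restrict (\<lambda>b. 0) {a}"
  "c \<odot>\<^bsub>point_space a\<^esub> f = restrict (\<lambda>b. c * f b) {a}"
  "inner (point_space a) f g = cnj (f a) * g a"
  by (simp_all add: point_space_def)

lemma nonzero_fd_hilbert_point_space: "nonzero_fd_hilbert (point_space a)"
proof -
  have ext: "f = g \<longleftrightarrow> f a = g a"
    if "f \<in> {a} \<rightarrow>\<^sub>E (UNIV :: complex set)" "g \<in> {a} \<rightarrow>\<^sub>E UNIV" for f g
    using that by (auto intro: PiE_ext)
  have "abelian_group (point_space a)"
  proof (rule abelian_groupI)
    fix f assume "f \<in> carrier (point_space a)"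
    then show "\<exists>g\<in>carrier (point_space a). g \<oplus>\<^bsub>point_space a\<^esub> f = \<zero>\<^bsub>point_space a\<^esub>"
      by (intro bexI[of _ "restrict (\<lambda>b. - f b) {a}"]) auto
  qed (auto simp: ext)
  then have V: "vectorspace complex_field (point_space a)"
    by (rule vectorspace_complexI) (auto simp: ext algebra_simps)
  interpret complex_space "point_space a" by (rule complex_spaceI[OF V])
  have "\<exists>c. f = c \<odot>\<^bsub>point_space a\<^esub> restrict (\<lambda>b. 1) {a}" if "f \<in> carrier (point_space a)" for f
    using that by (intro exI[of _ "f a"]) (auto simp: ext)
  then have "fin_dim" by (intro fin_dim_if_one_generator[of "restrict (\<lambda>b. 1) {a}"]) auto
  moreover have "restrict (\<lambda>b. 1) {a} \<in> carrier (point_space a)"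
    "restrict (\<lambda>b. 1) {a} \<noteq> \<zero>\<^bsub>point_space a\<^esub>"
    by (auto simp: ext)
  then have "carrier (point_space a) \<noteq> {\<zero>\<^bsub>point_space a\<^esub>}" by blast
  moreover have "0 < Re (cnj (f a) * f a)" if "f \<in> {a} \<rightarrow>\<^sub>E UNIV" "f \<noteq> restrict (\<lambda>b. 0) {a}" for f
    using that by (auto simp: ext complex_eq_iff sum_power2_gt_zero_iff simp flip: power2_eq_square)
  ultimately show ?thesis
    using V by (intro nonzero_fd_hilbert.intro nonzero_fd_hilbert_axioms.intro)
      (auto simp: algebra_simps)
qed

lemma inj_point_space: "point_space a = point_space b \<Longrightarrow> a = b"
proof -
  assume "point_space a = point_space b"
  then have eq: "{a} \<rightarrow>\<^sub>E (UNIV :: complex set) = {b} \<rightarrow>\<^sub>E UNIV"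
    by (metis point_space_simps(1))
  \<comment> \<open>If a and b differed, both functions would have the value
    \<open>undefined\<close> at a. Two constants are compared because a single one might happen to
    equal \<open>undefined\<close>.\<close>
  have "restrict (\<lambda>b. 0) {a} \<in> {a} \<rightarrow>\<^sub>E (UNIV :: complex set)" 
    "restrict (\<lambda>b. 1) {a} \<in> {a} \<rightarrow>\<^sub>E (UNIV :: complex set)" by auto
  then have "restrict (\<lambda>b. 0 :: complex) {a} \<in> {b} \<rightarrow>\<^sub>E UNIV" 
    "restrict (\<lambda>b. 1 :: complex) {a} \<in> {b} \<rightarrow>\<^sub>E UNIV" unfolding eq by auto
  then show "a = b"
    by (metis PiE_arb restrict_apply singletonD singletonI zero_neq_one)
qed

section \<open>Tensor products as spaces of conjugate-bilinear forms\<close>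

lemma tensor_space_simps [simp]:
  "carrier (tensor_space X Y) = {(X, Y)} \<times> conj_bilinear_forms X Y"
  "\<zero>\<^bsub>tensor_space X Y\<^esub> = ((X, Y), \<lambda>u v. 0)"
  "s \<oplus>\<^bsub>tensor_space X Y\<^esub> t = ((X, Y), \<lambda>u v. snd s u v + snd t u v)"
  "c \<odot>\<^bsub>tensor_space X Y\<^esub> t = ((X, Y), \<lambda>u v. c * snd t u v)"
  by (simp_all add: tensor_space_def)

lemma complex_space_tensor_space: "complex_space (tensor_space X Y)"
proof -
  have "abelian_group (tensor_space X Y)"
  proof (rule abelian_groupI)
    fix t assume "t \<in> carrier (tensor_space X Y)"
    then show "\<exists>s\<in>carrier (tensor_space X Y). s \<oplus>\<^bsub>tensor_space X Y\<^esub> t = \<zero>\<^bsub>tensor_space X Y\<^esub>"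
      by (intro bexI[of _ "((X, Y), \<lambda>u v. - snd t u v)"]) (auto simp: conj_bilinear_forms_def)
  qed (auto simp: conj_bilinear_forms_def fun_eq_iff algebra_simps)
  then show ?thesis
    by (intro complex_spaceI vectorspace_complexI)
      (auto simp: conj_bilinear_forms_def fun_eq_iff algebra_simps)
qed

lemma tensor_vec_closed:
  assumes "nonzero_fd_hilbert X" "nonzero_fd_hilbert Y" "x \<in> carrier X" "y \<in> carrier Y"
  shows "tensor_vec X Y x y \<in> carrier (tensor_space X Y)"
proof -
  interpret X: nonzero_fd_hilbert X by fact
  interpret Y: nonzero_fd_hilbert Y by fact
  show ?thesis
    using assms by (auto simp: tensor_vec_def conj_bilinear_forms_def X.inner_add_left
        Y.inner_add_left X.inner_smult_left Y.inner_smult_left algebra_simps)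
qed

lemma tensor_spaceD:
  assumes "T \<in> carrier (tensor_space X Y)"
  shows "\<And>u u' v. \<lbrakk>u \<in> carrier X; u' \<in> carrier X; v \<in> carrier Y\<rbrakk> \<Longrightarrow>
      snd T (u \<oplus>\<^bsub>X\<^esub> u') v = snd T u v + snd T u' v"
    and "\<And>u v v'. \<lbrakk>u \<in> carrier X; v \<in> carrier Y; v' \<in> carrier Y\<rbrakk> \<Longrightarrow>
      snd T u (v \<oplus>\<^bsub>Y\<^esub> v') = snd T u v + snd T u v'"
    and "\<And>c u v. \<lbrakk>u \<in> carrier X; v \<in> carrier Y\<rbrakk> \<Longrightarrow> snd T (c \<odot>\<^bsub>X\<^esub> u) v = cnj c * snd T u v"
    and "\<And>c u v. \<lbrakk>u \<in> carrier X; v \<in> carrier Y\<rbrakk> \<Longrightarrow> snd T u (c \<odot>\<^bsub>Y\<^esub> v) = cnj c * snd T u v"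
  using assms by (auto simp: conj_bilinear_forms_def)

lemma tensor_space_ext:
  assumes "T \<in> carrier (tensor_space X Y)" "T' \<in> carrier (tensor_space X Y)"
    and "\<And>u v. \<lbrakk>u \<in> carrier X; v \<in> carrier Y\<rbrakk> \<Longrightarrow> snd T u v = snd T' u v"
  shows "T = T'"
proof -
  have "snd T u v = snd T' u v" for u v
    using assms by (cases "u \<in> carrier X \<and> v \<in> carrier Y") (auto simp: conj_bilinear_forms_def)
  then show ?thesis using assms(1,2) by (auto simp: fun_eq_iff prod_eq_iff)
qed

lemma snd_tensor_vec:
  "\<lbrakk>u \<in> carrier X; v \<in> carrier Y\<rbrakk> \<Longrightarrow> snd (tensor_vec X Y x y) u v = inner X u x * inner Y v y"
  by (simp add: tensor_vec_def)

text \<open>Peeling again: if y represents v \<mapsto> T(a, v), then subtracting a \<otimes> y makes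
  T vanish at the basis vector a and changes nothing at the others, which are orthogonal to
  a.\<close>

lemma subspace_contains_tensor_vec:
  assumes "nonzero_fd_hilbert X" "nonzero_fd_hilbert Y"
    and N: "VectorSpace.subspace complex_field N (tensor_space X Y)"
    and pure: "\<And>x y. \<lbrakk>x \<in> carrier X; y \<in> carrier Y\<rbrakk> \<Longrightarrow> tensor_vec X Y x y \<in> N"
  shows "N = carrier (tensor_space X Y)"
proof -
  interpret X: nonzero_fd_hilbert X by fact
  interpret Y: nonzero_fd_hilbert Y by fact
  interpret L: complex_space "tensor_space X Y" by (rule complex_space_tensor_space)
  obtain E where E: "orthonormal_basis X E" using X.orthonormal_basis_exists by blast
  then have Ec: "E \<subseteq> carrier X" "finite E" by (auto simp: orthonormal_basis_def)
  have "T \<in> N"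
    if "A \<subseteq> E" "T \<in> carrier (tensor_space X Y)"
      "\<And>e v. \<lbrakk>e \<in> E - A; v \<in> carrier Y\<rbrakk> \<Longrightarrow> snd T e v = 0" for A T
    using finite_subset[OF that(1) Ec(2)] that
  proof (induction A arbitrary: T)
    case empty
    have "snd T u v = 0" if "u \<in> carrier X" "v \<in> carrier Y" for u v
      using E that
    proof (induction u rule: X.orthonormal_basis_induct)
      case zero
      show ?case using tensor_spaceD(3)[OF empty(2) X.M.zero_closed zero, of 0] by simp
    qed (use empty tensor_spaceD[OF empty(2)] in auto)
    then have "T = \<zero>\<^bsub>tensor_space X Y\<^esub>"
      using empty(2) L.M.zero_closed by (intro tensor_space_ext) (auto simp del: tensor_space_simps(1))
    then show ?case using N by (simp add: L.subspace_iff del: tensor_space_simps)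
  next
    case (insert a A)
    have a: "a \<in> carrier X" using insert.prems Ec by blast
    note T = tensor_spaceD[OF insert.prems(2)]
    have "\<exists>y\<in>carrier Y. \<forall>v\<in>carrier Y. inner Y v y = snd T a v"
      by (rule Y.riesz) (use T a in auto)
    then obtain y where y: "y \<in> carrier Y" "\<And>v. v \<in> carrier Y \<Longrightarrow> inner Y v y = snd T a v"
      by blast
    let ?k = "tensor_vec X Y a y"
    let ?T' = "T \<oplus>\<^bsub>tensor_space X Y\<^esub> (-1) \<odot>\<^bsub>tensor_space X Y\<^esub> ?k"
    have k: "?k \<in> carrier (tensor_space X Y)" using a y assms by (intro tensor_vec_closed)
    have "?T' \<in> N"
    proof (rule insert.IH)
      show "?T' \<in> carrier (tensor_space X Y)"
        using insert.prems(2) k by (intro L.M.add.m_closed L.scale_closed)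
      fix e v assume e: "e \<in> E - A" and v: "v \<in> carrier Y"
      show "snd ?T' e v = 0"
      proof (cases "e = a")
        case True
        then have "inner X e a = 1" using E e by (auto simp: orthonormal_basis_def)
        then show ?thesis using True a y v by (simp add: snd_tensor_vec)
      next
        case False
        then have "inner X e a = 0" "snd T e v = 0"
          using E e v insert.prems by (auto simp: orthonormal_basis_def)
        then show ?thesis using a e v Ec by (auto simp: snd_tensor_vec)
      qed
    qed (use insert.prems in auto)
    then show ?case using pure[OF a y(1)] by (rule L.subspace_diffD[OF N insert.prems(2)])
  qed
  from this[of E] show ?thesis using N by (auto simp: L.subspace_iff)
qed

text \<open>The equaliser of s and t is a subspace containing the pure tensors. This gives the
  uniqueness required by the descriptions defining \<open>tensor_op\<close> and the unit
  operators.\<close>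

lemma tensor_operators_ext:
  assumes "nonzero_fd_hilbert X" "nonzero_fd_hilbert Y" "complex_space Z"
    and s: "s \<in> carrier (operators (tensor_space X Y) Z)"
    and t: "t \<in> carrier (operators (tensor_space X Y) Z)"
    and eq: "\<And>x y. \<lbrakk>x \<in> carrier X; y \<in> carrier Y\<rbrakk> \<Longrightarrow> s (tensor_vec X Y x y) = t (tensor_vec X Y x y)"
  shows "s = t"
proof -
  interpret L: complex_space "tensor_space X Y" by (rule complex_space_tensor_space)
  let ?N = "{T \<in> carrier (tensor_space X Y). s T = t T}"
  have "?N = carrier (tensor_space X Y)"
  proof (rule subspace_contains_tensor_vec[OF assms(1,2)])
    show "VectorSpace.subspace complex_field ?N (tensor_space X Y)"
      unfolding L.subspace_iff
      using L.M.add.m_closed L.scale_closed L.M.zero_closed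
      by (auto simp: operators_add[OF s] operators_add[OF t] operators_scale[OF s]
          operators_scale[OF t] operators_zero[OF L.complex_space_axioms assms(3) s]
          operators_zero[OF L.complex_space_axioms assms(3) t] simp del: tensor_space_simps)
    show "\<And>x y. \<lbrakk>x \<in> carrier X; y \<in> carrier Y\<rbrakk> \<Longrightarrow> tensor_vec X Y x y \<in> ?N"
      using eq tensor_vec_closed[OF assms(1,2)] by blast
  qed
  then show ?thesis using s t by (intro operators_ext[OF s t]) blast
qed

text \<open>Precomposing a form with the two adjoints is linear in the form, and it is right on pure
  tensors because <r^dagger u, x> = <u, r x>. The formula then evaluates r1 \<otimes> r2 on every
  tensor, pure or not.\<close>

lemma
  assumes "nonzero_fd_hilbert X1" "nonzero_fd_hilbert X2" "nonzero_fd_hilbert Y1" "nonzero_fd_hilbert Y2"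
    and r1: "r1 \<in> carrier (operators X1 Y1)" and r2: "r2 \<in> carrier (operators X2 Y2)"
  shows tensor_op_operators:
      "tensor_op X1 X2 Y1 Y2 r1 r2 \<in> carrier (operators (tensor_space X1 X2) (tensor_space Y1 Y2))"
        (is ?A)
    and snd_tensor_op:
      "\<And>T u v. \<lbrakk>T \<in> carrier (tensor_space X1 X2); u \<in> carrier Y1; v \<in> carrier Y2\<rbrakk> \<Longrightarrow>
        snd (tensor_op X1 X2 Y1 Y2 r1 r2 T) u v = snd T (adjoint X1 Y1 r1 u) (adjoint X2 Y2 r2 v)"
        (is "PROP ?B")
proof -
  interpret X1: nonzero_fd_hilbert X1 by fact
  interpret X2: nonzero_fd_hilbert X2 by fact
  interpret Y1: nonzero_fd_hilbert Y1 by fact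
  interpret Y2: nonzero_fd_hilbert Y2 by fact
  interpret Y: complex_space "tensor_space Y1 Y2" by (rule complex_space_tensor_space)
  define s1 where "s1 = adjoint X1 Y1 r1"
  define s2 where "s2 = adjoint X2 Y2 r2"
  have s1: "s1 \<in> carrier (operators Y1 X1)"
    unfolding s1_def using assms by (intro adjoint_operators)
  have s2: "s2 \<in> carrier (operators Y2 X2)"
    unfolding s2_def using assms by (intro adjoint_operators)
  \<comment> \<open>The conditional keeps the resulting form zero off the carriers, as
    \<open>conj_bilinear_forms\<close> demands.\<close>
  define t where "t = restrict (\<lambda>T. ((Y1, Y2), \<lambda>u v. if u \<in> carrier Y1 \<and> v \<in> carrier Y2
    then snd T (s1 u) (s2 v) else 0)) (carrier (tensor_space X1 X2))"
  have t_op: "t \<in> carrier (operators (tensor_space X1 X2) (tensor_space Y1 Y2))"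
    using s1 s2 by (auto simp: operators_iff conj_bilinear_forms_def t_def fun_eq_iff algebra_simps)
  have t_vec: "t (tensor_vec X1 X2 x1 x2) = tensor_vec Y1 Y2 (r1 x1) (r2 x2)"
    if x: "x1 \<in> carrier X1" "x2 \<in> carrier X2" for x1 x2
  proof (rule tensor_space_ext)
    show "t (tensor_vec X1 X2 x1 x2) \<in> carrier (tensor_space Y1 Y2)"
      using x assms by (intro operators_closed[OF t_op] tensor_vec_closed)
    show "tensor_vec Y1 Y2 (r1 x1) (r2 x2) \<in> carrier (tensor_space Y1 Y2)"
      using x assms by (intro tensor_vec_closed operators_closed[OF r1] operators_closed[OF r2])
    fix u v assume uv: "u \<in> carrier Y1" "v \<in> carrier Y2"
    then show "snd (t (tensor_vec X1 X2 x1 x2)) u v = snd (tensor_vec Y1 Y2 (r1 x1) (r2 x2)) u v"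
      using tensor_vec_closed[OF assms(1,2) x] operators_closed[OF s1 uv(1)] operators_closed[OF s2 uv(2)]
      by (simp add: t_def snd_tensor_vec s1_def s2_def x inner_adjoint_left[OF assms(1,3) r1]
          inner_adjoint_left[OF assms(2,4) r2] del: tensor_space_simps)
  qed
  have "tensor_op X1 X2 Y1 Y2 r1 r2 = t"
    unfolding tensor_op_def
  proof (rule the_equality)
    fix t' assume "t' \<in> carrier (operators (tensor_space X1 X2) (tensor_space Y1 Y2)) \<and>
      (\<forall>x1\<in>carrier X1. \<forall>x2\<in>carrier X2.
        t' (tensor_vec X1 X2 x1 x2) = tensor_vec Y1 Y2 (r1 x1) (r2 x2))"
    then show "t' = t"
      using t_op t_vec by (intro tensor_operators_ext[OF assms(1,2) Y.complex_space_axioms]) auto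
  qed (use t_op t_vec in auto)
  then show ?A "PROP ?B"
    using t_op by (auto simp: t_def s1_def s2_def simp del: tensor_space_simps)
qed

text \<open>In terms of forms, the isomorphism of Y \<otimes> C with Y fixes the second argument at
  1 and takes the Riesz vector of what remains; y \<otimes> c is sent to c y because <1, c> =
  c.\<close>

lemma
  assumes "nonzero_fd_hilbert Y"
  shows right_unit_op_operators:
      "right_unit_op Y \<in> carrier (operators (tensor_space Y scalar_space) Y)" (is ?A)
    and inner_right_unit_op:
      "\<And>T u. \<lbrakk>T \<in> carrier (tensor_space Y scalar_space); u \<in> carrier Y\<rbrakk> \<Longrightarrow>
        inner Y u (right_unit_op Y T) = snd T u 1" (is "PROP ?B")
proof -
  interpret Y: nonzero_fd_hilbert Y by fact
  let ?C = "scalar_space"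
  have "\<exists>z\<in>carrier Y. \<forall>u\<in>carrier Y. inner Y u z = snd T u 1"
    if "T \<in> carrier (tensor_space Y ?C)" for T
    using tensor_spaceD[OF that] by (intro Y.riesz) auto
  then obtain g where g: "\<And>T. T \<in> carrier (tensor_space Y ?C) \<Longrightarrow> g T \<in> carrier Y"
    "\<And>T u. \<lbrakk>T \<in> carrier (tensor_space Y ?C); u \<in> carrier Y\<rbrakk> \<Longrightarrow> inner Y u (g T) = snd T u 1"
    by metis
  interpret L: complex_space "tensor_space Y ?C" by (rule complex_space_tensor_space)
  let ?t = "restrict g (carrier (tensor_space Y ?C))"
  have add: "g (S \<oplus>\<^bsub>tensor_space Y ?C\<^esub> T) = g S \<oplus>\<^bsub>Y\<^esub> g T"
    if "S \<in> carrier (tensor_space Y ?C)" "T \<in> carrier (tensor_space Y ?C)" for S T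
    using that L.M.add.m_closed[OF that]
    by (intro Y.inner_ext) (simp_all add: g Y.inner_add del: tensor_space_simps(1,3), simp)
  have smult: "g (c \<odot>\<^bsub>tensor_space Y ?C\<^esub> T) = c \<odot>\<^bsub>Y\<^esub> g T"
    if "T \<in> carrier (tensor_space Y ?C)" for c T
    using that L.scale_closed[OF that]
    by (intro Y.inner_ext) (simp_all add: g Y.inner_smult del: tensor_space_simps(1,4), simp)
  have t: "?t \<in> carrier (operators (tensor_space Y ?C) Y)"
    using g(1) add smult L.M.add.m_closed L.scale_closed
    by (simp add: operators_iff del: tensor_space_simps)
  have vec: "?t (tensor_vec Y ?C y c) = c \<odot>\<^bsub>Y\<^esub> y" if "y \<in> carrier Y" for y c
    using that g tensor_vec_closed[OF assms nonzero_fd_hilbert_scalar_space that, of c]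
    by (intro Y.inner_ext) (auto simp: snd_tensor_vec Y.inner_smult simp del: tensor_space_simps)
  have "right_unit_op Y = ?t"
    unfolding right_unit_op_def
    using t vec assms nonzero_fd_hilbert_scalar_space Y.complex_space_axioms
    by (intro the_equality) (auto intro!: tensor_operators_ext[of Y ?C Y])
  then show ?A "PROP ?B" using t g by (auto simp del: tensor_space_simps)
qed

lemma
  assumes "nonzero_fd_hilbert Y"
  shows left_unit_op_operators:
      "left_unit_op Y \<in> carrier (operators (tensor_space scalar_space Y) Y)" (is ?A)
    and inner_left_unit_op:
      "\<And>T u. \<lbrakk>T \<in> carrier (tensor_space scalar_space Y); u \<in> carrier Y\<rbrakk> \<Longrightarrow>
        inner Y u (left_unit_op Y T) = snd T 1 u" (is "PROP ?B")
proof -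
  interpret Y: nonzero_fd_hilbert Y by fact
  let ?C = "scalar_space"
  have "\<exists>z\<in>carrier Y. \<forall>u\<in>carrier Y. inner Y u z = snd T 1 u"
    if "T \<in> carrier (tensor_space ?C Y)" for T
    using tensor_spaceD[OF that] by (intro Y.riesz) auto
  then obtain g where g: "\<And>T. T \<in> carrier (tensor_space ?C Y) \<Longrightarrow> g T \<in> carrier Y"
    "\<And>T u. \<lbrakk>T \<in> carrier (tensor_space ?C Y); u \<in> carrier Y\<rbrakk> \<Longrightarrow> inner Y u (g T) = snd T 1 u"
    by metis
  interpret L: complex_space "tensor_space ?C Y" by (rule complex_space_tensor_space)
  let ?t = "restrict g (carrier (tensor_space ?C Y))"
  have add: "g (S \<oplus>\<^bsub>tensor_space ?C Y\<^esub> T) = g S \<oplus>\<^bsub>Y\<^esub> g T"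
    if "S \<in> carrier (tensor_space ?C Y)" "T \<in> carrier (tensor_space ?C Y)" for S T
    using that L.M.add.m_closed[OF that]
    by (intro Y.inner_ext) (simp_all add: g Y.inner_add del: tensor_space_simps(1,3), simp)
  have smult: "g (c \<odot>\<^bsub>tensor_space ?C Y\<^esub> T) = c \<odot>\<^bsub>Y\<^esub> g T"
    if "T \<in> carrier (tensor_space ?C Y)" for c T
    using that L.scale_closed[OF that]
    by (intro Y.inner_ext) (simp_all add: g Y.inner_smult del: tensor_space_simps(1,4), simp)
  have t: "?t \<in> carrier (operators (tensor_space ?C Y) Y)"
    using g(1) add smult L.M.add.m_closed L.scale_closed
    by (simp add: operators_iff del: tensor_space_simps)
  have vec: "?t (tensor_vec ?C Y c y) = c \<odot>\<^bsub>Y\<^esub> y" if "y \<in> carrier Y" for y c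
    using that g tensor_vec_closed[OF nonzero_fd_hilbert_scalar_space assms _ that, of c]
    by (intro Y.inner_ext) (auto simp: snd_tensor_vec Y.inner_smult simp del: tensor_space_simps)
  have "left_unit_op Y = ?t"
    unfolding left_unit_op_def
    using t vec assms nonzero_fd_hilbert_scalar_space Y.complex_space_axioms
    by (intro the_equality) (auto intro!: tensor_operators_ext[of ?C Y Y])
  then show ?A "PROP ?B" using t g by (auto simp del: tensor_space_simps)
qed

section \<open>Relations\<close>

lemma span_rel_subspace:
  assumes "complex_space X" "complex_space Y" "X \<in> \<X>" "Y \<in> \<Y>" "B X Y \<subseteq> carrier (operators X Y)"
  shows "VectorSpace.subspace complex_field (span_rel \<X> \<Y> B X Y) (operators X Y)"
proof -
  interpret L: complex_space "operators X Y" using assms by (intro complex_space_operators)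
  show ?thesis using assms L.subspace_span by (simp add: span_rel_def)
qed

lemma span_rel_mem:
  assumes "complex_space X" "complex_space Y" "X \<in> \<X>" "Y \<in> \<Y>" "r \<in> B X Y"
    and "r \<in> carrier (operators X Y)"
  shows "r \<in> span_rel \<X> \<Y> B X Y"
proof -
  interpret L: complex_space "operators X Y" using assms by (intro complex_space_operators)
  show ?thesis using assms L.mem_span by (simp add: span_rel_def)
qed

lemma span_rel_least:
  assumes "complex_space X" "complex_space Y" "B X Y \<subseteq> N"
    and "VectorSpace.subspace complex_field N (operators X Y)"
  shows "span_rel \<X> \<Y> B X Y \<subseteq> N"
proof -
  interpret L: complex_space "operators X Y" using assms by (intro complex_space_operators)
  show ?thesis using assms L.span_least by (simp add: span_rel_def)
qed

lemma carrier_operators_subspace: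
  assumes "complex_space X" "complex_space Y"
  shows "VectorSpace.subspace complex_field (carrier (operators X Y)) (operators X Y)"
proof -
  interpret L: complex_space "operators X Y" using assms by (intro complex_space_operators)
  show ?thesis by (simp add: L.subspace_iff del: operators_simps)
qed

lemma zero_operators_subspace:
  assumes "complex_space X" "complex_space Y"
  shows "VectorSpace.subspace complex_field {\<zero>\<^bsub>operators X Y\<^esub>} (operators X Y)"
proof -
  interpret L: complex_space "operators X Y" using assms by (intro complex_space_operators)
  show ?thesis by (simp add: L.subspace_iff del: operators_simps)
qed

lemma span_rel_closed:
  assumes "complex_space X" "complex_space Y" "B X Y \<subseteq> carrier (operators X Y)"
  shows "span_rel \<X> \<Y> B X Y \<subseteq> carrier (operators X Y)"
  using assms by (intro span_rel_least carrier_operators_subspace)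

lemma rel_comp_mem:
  assumes "complex_space X" "complex_space Z" "X \<in> \<X>" "Y \<in> \<Y>" "Z \<in> \<Z>"
    and "s \<in> S Y Z" "r \<in> R X Y" "s \<in> carrier (operators Y Z)" "r \<in> carrier (operators X Y)"
  shows "compose (carrier X) s r \<in> rel_comp \<X> \<Y> \<Z> S R X Z"
  unfolding rel_comp_def using assms by (intro span_rel_mem compose_operators) auto

lemma rel_comp_least:
  assumes "complex_space X" "complex_space Z"
    and "VectorSpace.subspace complex_field N (operators X Z)"
    and "\<And>Y s r. \<lbrakk>Y \<in> \<Y>; s \<in> S Y Z; r \<in> R X Y\<rbrakk> \<Longrightarrow> compose (carrier X) s r \<in> N"
  shows "rel_comp \<X> \<Y> \<Z> S R X Z \<subseteq> N"
  unfolding rel_comp_def using assms by (intro span_rel_least) auto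

lemma rel_comp_subspace:
  assumes "complex_space X" "complex_space Z" "X \<in> \<X>" "Z \<in> \<Z>"
    and "\<And>Y. Y \<in> \<Y> \<Longrightarrow> S Y Z \<subseteq> carrier (operators Y Z)"
    and "\<And>Y. Y \<in> \<Y> \<Longrightarrow> R X Y \<subseteq> carrier (operators X Y)"
  shows "VectorSpace.subspace complex_field (rel_comp \<X> \<Y> \<Z> S R X Z) (operators X Z)"
proof -
  have "compose (carrier X) s r \<in> carrier (operators X Z)"
    if "Y \<in> \<Y>" "s \<in> S Y Z" "r \<in> R X Y" for Y s r
    using compose_operators[OF assms(1), of s Y Z r] assms(5,6)[OF that(1)] that by blast
  then show ?thesis
    unfolding rel_comp_def using assms(1-4) by (intro span_rel_subspace) auto
qed

lemma rel_comp_closed: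
  assumes "complex_space X" "complex_space Z"
    and "\<And>Y. Y \<in> \<Y> \<Longrightarrow> S Y Z \<subseteq> carrier (operators Y Z)"
    and "\<And>Y. Y \<in> \<Y> \<Longrightarrow> R X Y \<subseteq> carrier (operators X Y)"
  shows "rel_comp \<X> \<Y> \<Z> S R X Z \<subseteq> carrier (operators X Z)"
proof (rule rel_comp_least[OF assms(1,2) carrier_operators_subspace[OF assms(1,2)]])
  fix Y s r assume "Y \<in> \<Y>" "s \<in> S Y Z" "r \<in> R X Y"
  then show "compose (carrier X) s r \<in> carrier (operators X Z)"
    using compose_operators[OF assms(1), of s Y Z r] assms(3,4) by blast
qed

text \<open>Used contrapositively: if a composite contains a nonzero identity operator, then its
  first factor has a nonzero component.\<close>

lemma rel_comp_zero:
  assumes "complex_space X" "complex_space Z"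
    and "\<And>Y. Y \<in> \<Y> \<Longrightarrow> complex_space Y"
    and "\<And>Y. Y \<in> \<Y> \<Longrightarrow> S Y Z \<subseteq> carrier (operators Y Z)"
    and "\<And>Y. Y \<in> \<Y> \<Longrightarrow> R X Y \<subseteq> {\<zero>\<^bsub>operators X Y\<^esub>}"
  shows "rel_comp \<X> \<Y> \<Z> S R X Z \<subseteq> {\<zero>\<^bsub>operators X Z\<^esub>}"
proof (rule rel_comp_least[OF assms(1,2) zero_operators_subspace[OF assms(1,2)]])
  fix Y s r assume *: "Y \<in> \<Y>" "s \<in> S Y Z" "r \<in> R X Y"
  then have "r = \<zero>\<^bsub>operators X Y\<^esub>" "s \<zero>\<^bsub>Y\<^esub> = \<zero>\<^bsub>Z\<^esub>"
    using assms operators_zero[of Y Z s] by blast+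
  then show "compose (carrier X) s r \<in> {\<zero>\<^bsub>operators X Z\<^esub>}"
    by (simp add: compose_def fun_eq_iff)
qed

lemma quantum_setD: "\<lbrakk>quantum_set \<X>; X \<in> \<X>\<rbrakk> \<Longrightarrow> nonzero_fd_hilbert X"
  by (simp add: quantum_set_def)

lemma quantum_set_complex_space: "\<lbrakk>quantum_set \<X>; X \<in> \<X>\<rbrakk> \<Longrightarrow> complex_space X"
  by (metis quantum_setD nonzero_fd_hilbert_complex_space)

lemma quantum_set_one_qset: "quantum_set one_qset"
  by (simp add: quantum_set_def one_qset_def nonzero_fd_hilbert_scalar_space)

lemma quantum_set_classical_qset: "quantum_set (classical_qset S)"
  by (auto simp: quantum_set_def classical_qset_def nonzero_fd_hilbert_point_space)

text \<open>Components off the atoms are empty, so membership of r already shows that its indices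
  are atoms.\<close>

lemma binary_relations_closed:
  assumes "R \<in> binary_relations \<X> \<Y>" "r \<in> R X Y"
  shows "X \<in> \<X>" "Y \<in> \<Y>" "r \<in> carrier (operators X Y)"
proof -
  show *: "X \<in> \<X>" "Y \<in> \<Y>" using assms by (force simp: binary_relations_def)+
  then have "VectorSpace.subspace complex_field (R X Y) (operators X Y)"
    using assms by (auto simp: binary_relations_def)
  then show "r \<in> carrier (operators X Y)"
    using assms(2) by (auto simp: VectorSpace.subspace_def LinearCombinations.submodule_def)
qed

section \<open>The identity relation\<close>

lemma identity_operator_nonzero:
  assumes "nonzero_fd_hilbert X"
  shows "identity_operator X \<noteq> \<zero>\<^bsub>operators X X\<^esub>"
proof -
  interpret X: nonzero_fd_hilbert X by fact
  obtain x where "x \<in> carrier X" "x \<noteq> \<zero>\<^bsub>X\<^esub>" using X.exists_nonzero by blast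
  then show ?thesis by (auto simp: identity_operator_def fun_eq_iff)
qed

lemma identity_operator_mem_id_rel:
  "\<lbrakk>complex_space X; X \<in> \<X>\<rbrakk> \<Longrightarrow> identity_operator X \<in> id_rel \<X> X X"
  unfolding id_rel_def by (intro span_rel_mem identity_operator_operators) auto

lemma id_rel_self_least:
  assumes "complex_space X" "VectorSpace.subspace complex_field N (operators X X)"
    and "identity_operator X \<in> N"
  shows "id_rel \<X> X X \<subseteq> N"
  unfolding id_rel_def using assms by (intro span_rel_least) auto

lemma id_rel_distinct:
  assumes "complex_space X" "complex_space X'" "X \<noteq> X'"
  shows "id_rel \<X> X X' \<subseteq> {\<zero>\<^bsub>operators X X'\<^esub>}"
  unfolding id_rel_def using assms by (intro span_rel_least zero_operators_subspace) auto

lemma id_rel_selfD: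
  assumes "complex_space X" "r \<in> id_rel \<X> X X"
  shows "\<exists>c. \<forall>x\<in>carrier X. r x = c \<odot>\<^bsub>X\<^esub> x"
proof -
  interpret X: complex_space X by fact
  interpret L: complex_space "operators X X" using assms by (intro complex_space_operators)
  let ?N = "{r \<in> carrier (operators X X). \<exists>c. \<forall>x\<in>carrier X. r x = c \<odot>\<^bsub>X\<^esub> x}"
  have "VectorSpace.subspace complex_field ?N (operators X X)"
    unfolding L.subspace_iff
  proof (intro conjI ballI allI)
    show "\<zero>\<^bsub>operators X X\<^esub> \<in> ?N"
      using L.M.zero_closed by (auto simp del: operators_simps(1)) (auto intro!: exI[of _ 0])
    fix r assume r: "r \<in> ?N"
    then obtain c where c: "\<And>x. x \<in> carrier X \<Longrightarrow> r x = c \<odot>\<^bsub>X\<^esub> x" by auto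
    show "a \<odot>\<^bsub>operators X X\<^esub> r \<in> ?N" for a
      using r c L.scale_closed[of r a] by (auto simp: X.scale_scale)
    fix s assume s: "s \<in> ?N"
    then obtain d where d: "\<And>x. x \<in> carrier X \<Longrightarrow> s x = d \<odot>\<^bsub>X\<^esub> x" by auto
    show "r \<oplus>\<^bsub>operators X X\<^esub> s \<in> ?N"
      using r s c d L.M.add.m_closed[of r s]
      by (auto simp: X.scale_add_left[symmetric])
  qed blast
  moreover have "identity_operator X \<in> ?N"
    using identity_operator_operators[OF assms(1)]
    by (auto simp: identity_operator_def intro!: exI[of _ 1])
  ultimately show ?thesis using id_rel_self_least[OF assms(1)] assms(2) by blast
qed

lemma id_rel_closed:
  assumes "complex_space X" "complex_space X'"
  shows "id_rel \<X> X X' \<subseteq> carrier (operators X X')"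
  unfolding id_rel_def using assms by (intro span_rel_closed) (auto intro: identity_operator_operators)

text \<open>The zero space qualifies as well; for atoms, which are nonzero, this means dimension
  exactly one.\<close>

definition one_dimensional :: "'a hspace \<Rightarrow> bool" where
  "one_dimensional Y \<longleftrightarrow> (\<exists>w\<in>carrier Y. \<forall>y\<in>carrier Y. \<exists>c. y = c \<odot>\<^bsub>Y\<^esub> w)"

lemma one_dimensional_scalar_space: "one_dimensional scalar_space"
  unfolding one_dimensional_def by (rule bexI[of _ 1]) auto

text \<open>An operator is determined by its value on a generator w, and that value is a multiple of
  w. This is how a full diagonal component can satisfy F F^dagger \<le> I.\<close>

lemma one_dimensional_operators:
  assumes "nonzero_fd_hilbert Y" "one_dimensional Y" "Y \<in> \<Y>"
  shows "carrier (operators Y Y) \<subseteq> id_rel \<Y> Y Y"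
proof
  interpret Y: nonzero_fd_hilbert Y by fact
  interpret L: complex_space "operators Y Y" by (intro complex_space_operators Y.complex_space_axioms)
  fix r assume r: "r \<in> carrier (operators Y Y)"
  obtain w where w: "w \<in> carrier Y" "\<And>y. y \<in> carrier Y \<Longrightarrow> \<exists>c. y = c \<odot>\<^bsub>Y\<^esub> w"
    using assms(2) by (auto simp: one_dimensional_def)
  obtain c where c: "r w = c \<odot>\<^bsub>Y\<^esub> w" using w operators_closed[OF r w(1)] by blast
  have "r = c \<odot>\<^bsub>operators Y Y\<^esub> identity_operator Y"
  proof (rule operators_ext[OF r])
    show "c \<odot>\<^bsub>operators Y Y\<^esub> identity_operator Y \<in> carrier (operators Y Y)"
      by (intro L.scale_closed identity_operator_operators Y.complex_space_axioms)
    fix y assume y: "y \<in> carrier Y"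
    then obtain d where "y = d \<odot>\<^bsub>Y\<^esub> w" using w by blast
    then show "r y = (c \<odot>\<^bsub>operators Y Y\<^esub> identity_operator Y) y"
      using y w c by (simp add: operators_scale[OF r] identity_operator_def Y.scale_scale mult.commute)
  qed
  moreover have "VectorSpace.subspace complex_field (id_rel \<Y> Y Y) (operators Y Y)"
    unfolding id_rel_def using assms Y.complex_space_axioms
    by (intro span_rel_subspace) (auto intro: identity_operator_operators)
  ultimately show "r \<in> id_rel \<Y> Y Y"
    using identity_operator_mem_id_rel[OF Y.complex_space_axioms assms(3)]
    by (simp add: L.subspace_iff del: operators_simps)
qed

section \<open>The calculus of block relations\<close>

lemma block_rel_closed:
  "\<lbrakk>complex_space X; complex_space Y\<rbrakk> \<Longrightarrow> block_rel \<X> \<Y> P X Y \<subseteq> carrier (operators X Y)"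
  using carrier_operators_subspace zero_operators_subspace
  by (auto simp: block_rel_def VectorSpace.subspace_def LinearCombinations.submodule_def
      simp del: operators_simps)

lemma block_rel_binary_relations:
  "\<lbrakk>quantum_set \<X>; quantum_set \<Y>\<rbrakk> \<Longrightarrow> block_rel \<X> \<Y> P \<in> binary_relations \<X> \<Y>"
  by (auto simp: block_rel_def binary_relations_def carrier_operators_subspace
      zero_operators_subspace quantum_set_complex_space simp del: operators_simps)

lemma block_rel_cong:
  "(\<And>X Y. \<lbrakk>X \<in> \<X>; Y \<in> \<Y>\<rbrakk> \<Longrightarrow> P X Y \<longleftrightarrow> P' X Y) \<Longrightarrow> block_rel \<X> \<Y> P = block_rel \<X> \<Y> P'"
  by (auto simp: block_rel_def fun_eq_iff)

text \<open>Zero and full components can be told apart because L(X, Y) is nonzero for nonzero X and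
  Y. The uniqueness of f depends on this.\<close>

lemma block_rel_eqD:
  assumes "quantum_set \<X>" "quantum_set \<Y>" "block_rel \<X> \<Y> P = block_rel \<X> \<Y> P'" "X \<in> \<X>" "Y \<in> \<Y>"
  shows "P X Y \<longleftrightarrow> P' X Y"
  using fun_cong[OF fun_cong[OF assms(3)], of X Y] assms(4,5)
    operators_nonzero[OF quantum_setD[OF assms(1,4)] quantum_setD[OF assms(2,5)]]
  by (auto simp: block_rel_def simp del: operators_simps split: if_splits)

text \<open>A rank-one operator factors through every nonzero space Y, by way of any nonzero vector
  y of Y.\<close>

lemma rank_one_factor:
  assumes "nonzero_fd_hilbert X" "nonzero_fd_hilbert Y" "complex_space Z"
    and "w \<in> carrier Z" "z \<in> carrier X"
  obtains r s where "r \<in> carrier (operators X Y)" "s \<in> carrier (operators Y Z)"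
    "compose (carrier X) s r = rank_one X Z w z"
proof -
  interpret Y: nonzero_fd_hilbert Y by fact
  interpret Z: complex_space Z by fact
  obtain y where y: "y \<in> carrier Y" "y \<noteq> \<zero>\<^bsub>Y\<^esub>" using Y.exists_nonzero by blast
  \<comment> \<open>The inverse of <y, y> is there to make \<open>?s y = w\<close>.\<close>
  let ?r = "rank_one X Y y z" and ?s = "rank_one Y Z (inverse (inner Y y y) \<odot>\<^bsub>Z\<^esub> w) y"
  have s: "?s \<in> carrier (operators Y Z)" using assms y by (intro rank_one_operators) auto
  have "?s y = w" using y assms by (simp add: rank_one_def Z.scale_scale)
  then have "compose (carrier X) ?s ?r = rank_one X Z w z"
    using compose_rank_one[OF assms(1) Y.complex_space_axioms s y(1) assms(5)] by simp
  moreover have "?r \<in> carrier (operators X Y)"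
    using assms y Y.complex_space_axioms by (intro rank_one_operators) auto
  ultimately show thesis using s that by blast
qed

text \<open>If some Y links X to Z, then every rank-one operator from X to Z factors through Y, and
  these span L(X, Z). If none does, each product has a zero factor. Block relations thus compose
  like their predicates.\<close>

lemma rel_comp_block_rel:
  assumes "quantum_set \<X>" "quantum_set \<Y>" "quantum_set \<Z>"
  shows "rel_comp \<X> \<Y> \<Z> (block_rel \<Y> \<Z> Q) (block_rel \<X> \<Y> P) =
    block_rel \<X> \<Z> (\<lambda>X Z. \<exists>Y\<in>\<Y>. P X Y \<and> Q Y Z)"
proof (intro ext)
  fix X Z
  show "rel_comp \<X> \<Y> \<Z> (block_rel \<Y> \<Z> Q) (block_rel \<X> \<Y> P) X Z =
    block_rel \<X> \<Z> (\<lambda>X Z. \<exists>Y\<in>\<Y>. P X Y \<and> Q Y Z) X Z"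
  proof (cases "X \<in> \<X> \<and> Z \<in> \<Z>")
    case False
    then show ?thesis by (auto simp: rel_comp_def span_rel_def block_rel_def)
  next
    case True
    then have H: "nonzero_fd_hilbert X" "nonzero_fd_hilbert Z" using assms quantum_setD by auto
    note C = H[THEN nonzero_fd_hilbert_complex_space]
    note YC = quantum_set_complex_space[OF assms(2)]
    have sub: "VectorSpace.subspace complex_field
      (rel_comp \<X> \<Y> \<Z> (block_rel \<Y> \<Z> Q) (block_rel \<X> \<Y> P) X Z) (operators X Z)"
      using True C YC by (intro rel_comp_subspace block_rel_closed) auto
    show ?thesis
    proof (cases "\<exists>Y\<in>\<Y>. P X Y \<and> Q Y Z")
      case t: True
      then obtain Y where Y: "Y \<in> \<Y>" "P X Y" "Q Y Z" by blast
      have "rank_one X Z w z \<in> rel_comp \<X> \<Y> \<Z> (block_rel \<Y> \<Z> Q) (block_rel \<X> \<Y> P) X Z"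
        if wz: "w \<in> carrier Z" "z \<in> carrier X" for w z
      proof -
        obtain r s where rs: "r \<in> carrier (operators X Y)" "s \<in> carrier (operators Y Z)"
          "compose (carrier X) s r = rank_one X Z w z"
          using rank_one_factor[OF H(1) quantum_setD[OF assms(2) Y(1)] C(2) wz] by blast
        have "compose (carrier X) s r \<in> rel_comp \<X> \<Y> \<Z> (block_rel \<Y> \<Z> Q) (block_rel \<X> \<Y> P) X Z"
          using True Y rs by (intro rel_comp_mem[OF C, of \<X> Y]) (auto simp: block_rel_def)
        then show ?thesis by (simp add: rs)
      qed
      then show ?thesis
        using subspace_contains_rank_one[OF H(1) C(2) sub] True t by (simp add: block_rel_def)
    next
      case f: False
      have "compose (carrier X) s r \<in> {\<zero>\<^bsub>operators X Z\<^esub>}"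
        if Y: "Y \<in> \<Y>" "s \<in> block_rel \<Y> \<Z> Q Y Z" "r \<in> block_rel \<X> \<Y> P X Y" for Y s r
      proof -
        have s: "s \<in> carrier (operators Y Z)" using block_rel_closed[OF YC[OF Y(1)] C(2)] Y by blast
        have r: "r \<in> carrier (operators X Y)" using block_rel_closed[OF C(1) YC[OF Y(1)]] Y by blast
        have "s = \<zero>\<^bsub>operators Y Z\<^esub> \<or> r = \<zero>\<^bsub>operators X Y\<^esub>"
          using f Y by (auto simp: block_rel_def simp del: operators_simps split: if_splits)
        then show ?thesis
          using operators_zero[OF YC[OF Y(1)] C(2) s] operators_closed[OF r]
          by (auto simp: compose_def fun_eq_iff)
      qed
      then have "rel_comp \<X> \<Y> \<Z> (block_rel \<Y> \<Z> Q) (block_rel \<X> \<Y> P) X Z \<subseteq> {\<zero>\<^bsub>operators X Z\<^esub>}"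
        by (intro rel_comp_least[OF C] zero_operators_subspace[OF C])
      moreover interpret L: complex_space "operators X Z" by (intro complex_space_operators C)
      have "\<zero>\<^bsub>operators X Z\<^esub> \<in> rel_comp \<X> \<Y> \<Z> (block_rel \<Y> \<Z> Q) (block_rel \<X> \<Y> P) X Z"
        using sub by (simp add: L.subspace_iff del: operators_simps)
      ultimately show ?thesis
        using True f by (auto simp: block_rel_def simp del: operators_simps)
    qed
  qed
qed

lemma dagger_block_rel:
  assumes "quantum_set \<X>" "quantum_set \<Y>"
  shows "dagger (block_rel \<X> \<Y> P) = block_rel \<Y> \<X> (\<lambda>Y X. P X Y)"
  using quantum_setD[OF assms(1)] quantum_setD[OF assms(2)]
  by (auto simp: dagger_def block_rel_def fun_eq_iff adjoint_image_operators adjoint_zero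
      simp del: operators_simps)

text \<open>Totality makes the diagonal components of F^dagger F full, so that they contain the
  identity. Uniqueness makes the off-diagonal components of F F^dagger zero, and one-dimensionality
  reduces the diagonal ones to scalars.\<close>

lemma block_rel_Fun:
  assumes "quantum_set \<X>" "quantum_set \<Y>"
    and total: "\<And>X. X \<in> \<X> \<Longrightarrow> \<exists>Y\<in>\<Y>. P X Y"
    and unique: "\<And>X Y Y'. \<lbrakk>X \<in> \<X>; Y \<in> \<Y>; Y' \<in> \<Y>; P X Y; P X Y'\<rbrakk> \<Longrightarrow> Y = Y'"
    and one_dim: "\<And>X Y. \<lbrakk>X \<in> \<X>; Y \<in> \<Y>; P X Y\<rbrakk> \<Longrightarrow> one_dimensional Y"
  shows "block_rel \<X> \<Y> P \<in> Fun \<X> \<Y>"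
proof -
  have "id_rel \<X> X X' \<subseteq> block_rel \<X> \<X> (\<lambda>X X'. \<exists>Y\<in>\<Y>. P X Y \<and> P X' Y) X X'" for X X'
  proof (cases "X \<in> \<X> \<and> X' \<in> \<X>")
    case True
    then have C: "complex_space X" "complex_space X'" using assms quantum_set_complex_space by auto
    interpret L: complex_space "operators X X'" by (intro complex_space_operators C)
    show ?thesis
    proof (cases "X = X'")
      case eq: True
      then show ?thesis
        using True total[of X] id_rel_closed[OF C, of \<X>] by (auto simp: block_rel_def simp del: operators_simps)
    next
      case False
      then show ?thesis
        using True id_rel_distinct[OF C, of \<X>] L.M.zero_closed
        by (auto simp: block_rel_def simp del: operators_simps)
    qed
  qed (auto simp: id_rel_def span_rel_def)
  moreover have "block_rel \<Y> \<Y> (\<lambda>Y Y'. \<exists>X\<in>\<X>. P X Y \<and> P X Y') Y Y' \<subseteq> id_rel \<Y> Y Y'" for Y Y'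
  proof (cases "Y \<in> \<Y> \<and> Y' \<in> \<Y>")
    case True
    then have C: "complex_space Y" "complex_space Y'" using assms quantum_set_complex_space by auto
    interpret L: complex_space "operators Y Y'" by (intro complex_space_operators C)
    have "VectorSpace.subspace complex_field (id_rel \<Y> Y Y') (operators Y Y')"
      unfolding id_rel_def using True C by (intro span_rel_subspace) (auto intro: identity_operator_operators)
    then have z: "\<zero>\<^bsub>operators Y Y'\<^esub> \<in> id_rel \<Y> Y Y'" by (simp add: L.subspace_iff del: operators_simps)
    show ?thesis
    proof (cases "\<exists>X\<in>\<X>. P X Y \<and> P X Y'")
      case t: True
      then have "Y = Y'" "one_dimensional Y" using True unique one_dim by blast+
      then show ?thesis
        using True one_dimensional_operators[OF quantum_setD[OF assms(2)], of Y] t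
        by (simp add: block_rel_def)
    next
      case False
      then have "block_rel \<Y> \<Y> (\<lambda>Y Y'. \<exists>X\<in>\<X>. P X Y \<and> P X Y') Y Y' = {\<zero>\<^bsub>operators Y Y'\<^esub>}"
        using True by (auto simp: block_rel_def simp del: operators_simps)
      then show ?thesis using z by simp
    qed
  qed (auto simp: block_rel_def)
  ultimately show ?thesis
    by (auto simp: Fun_def le_fun_def block_rel_binary_relations assms dagger_block_rel rel_comp_block_rel)
qed

section \<open>Nonvanishing of functions and the function to the terminal object\<close>

lemma Fun_binary_relations: "F \<in> Fun \<X> \<Y> \<Longrightarrow> F \<in> binary_relations \<X> \<Y>"
  by (simp add: Fun_def)

lemma Fun_subspace:
  "\<lbrakk>F \<in> Fun \<X> \<Y>; X \<in> \<X>; Y \<in> \<Y>\<rbrakk> \<Longrightarrow> VectorSpace.subspace complex_field (F X Y) (operators X Y)"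
  by (auto simp: Fun_def binary_relations_def)

lemma dagger_closed:
  assumes "quantum_set \<X>" "quantum_set \<Y>" "R \<in> binary_relations \<X> \<Y>"
  shows "dagger R Y X \<subseteq> carrier (operators Y X)"
proof
  fix s assume "s \<in> dagger R Y X"
  then obtain r where r: "r \<in> R X Y" "s = adjoint X Y r" by (auto simp: dagger_def)
  then show "s \<in> carrier (operators Y X)"
    using binary_relations_closed[OF assms(3) r(1)] assms(1,2)
    by (auto intro!: adjoint_operators quantum_setD[OF assms(1)] quantum_setD[OF assms(2)])
qed

lemma Fun_nonzero:
  assumes "quantum_set \<X>" "quantum_set \<Y>" "F \<in> Fun \<X> \<Y>" "X \<in> \<X>"
  shows "\<exists>Y\<in>\<Y>. \<exists>r\<in>F X Y. r \<noteq> \<zero>\<^bsub>operators X Y\<^esub>"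
proof (rule ccontr)
  assume "\<not> ?thesis"
  then have "F X Y \<subseteq> {\<zero>\<^bsub>operators X Y\<^esub>}" if "Y \<in> \<Y>" for Y using that by blast
  then have "rel_comp \<X> \<Y> \<X> (dagger F) F X X \<subseteq> {\<zero>\<^bsub>operators X X\<^esub>}"
    using assms
    by (intro rel_comp_zero dagger_closed) (auto simp: Fun_def quantum_set_complex_space)
  moreover have "identity_operator X \<in> rel_comp \<X> \<Y> \<X> (dagger F) F X X"
    using assms identity_operator_mem_id_rel[OF quantum_set_complex_space[OF assms(1,4)] assms(4)]
    by (auto simp: Fun_def le_fun_def)
  ultimately show False using identity_operator_nonzero[OF quantum_setD[OF assms(1,4)]] by blast
qed

text \<open>Existence is an instance of \<open>block_rel_Fun\<close>. For uniqueness let F be any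
  function to \<open>one_qset\<close> and \<phi> a functional on X. Then 1_X is a combination of
  products s r with r in F(X, C), so \<phi> is a combination of the products \<phi> s r, each of
  which is a scalar multiple of r.\<close>

lemma terminal_map_eq:
  assumes "quantum_set \<X>"
  shows "terminal_map \<X> = block_rel \<X> one_qset (\<lambda>_ _. True)"
  unfolding terminal_map_def
proof (rule the_equality)
  show "block_rel \<X> one_qset (\<lambda>_ _. True) \<in> Fun \<X> one_qset"
    using assms quantum_set_one_qset one_dimensional_scalar_space
    by (intro block_rel_Fun) (auto simp: one_qset_def)
  fix F :: "('a, complex) qrel" assume F: "F \<in> Fun \<X> one_qset"
  let ?C = "scalar_space"
  note CC = nonzero_fd_hilbert_complex_space[OF nonzero_fd_hilbert_scalar_space]
  have "F X ?C = carrier (operators X ?C)" if X: "X \<in> \<X>" for X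
  proof (intro equalityI subsetI)
    fix r assume "r \<in> F X ?C"
    then show "r \<in> carrier (operators X ?C)"
      using binary_relations_closed F by (auto simp: Fun_def)
  next
    fix \<phi> assume \<phi>: "\<phi> \<in> carrier (operators X ?C)"
    interpret X: nonzero_fd_hilbert X using assms X by (rule quantum_setD)
    note XC = X.complex_space_axioms
    interpret XX: complex_space "operators X X" by (intro complex_space_operators XC)
    interpret XC: complex_space "operators X ?C" by (intro complex_space_operators XC CC)
    have sub: "VectorSpace.subspace complex_field (F X ?C) (operators X ?C)"
      using Fun_subspace[OF F X] by (simp add: one_qset_def)
    \<comment> \<open>Membership of 1_X in this subspace means \<phi> \<in> F(X, C). It is enough
      that it contains F^dagger F, which contains 1_X.\<close>
    let ?N = "{t \<in> carrier (operators X X). compose (carrier X) \<phi> t \<in> F X ?C}"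
    have "VectorSpace.subspace complex_field ?N (operators X X)"
      unfolding XX.subspace_iff
    proof (intro conjI ballI allI)
      have "compose (carrier X) \<phi> \<zero>\<^bsub>operators X X\<^esub> = \<zero>\<^bsub>operators X ?C\<^esub>"
        using operators_zero[OF XC CC \<phi>] by (auto simp: compose_def fun_eq_iff)
      then show "\<zero>\<^bsub>operators X X\<^esub> \<in> ?N"
        using sub by (simp add: XC.subspace_iff del: operators_simps)
      fix s assume s: "s \<in> ?N"
      have "compose (carrier X) \<phi> (a \<odot>\<^bsub>operators X X\<^esub> s) =
        a \<odot>\<^bsub>operators X ?C\<^esub> compose (carrier X) \<phi> s" for a
        using s by (auto simp: compose_def fun_eq_iff operators_scale[OF \<phi>] operators_closed[of s X X])
      then show "a \<odot>\<^bsub>operators X X\<^esub> s \<in> ?N" for a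
        using s sub by (simp add: XC.subspace_iff del: operators_simps)
      fix t assume t: "t \<in> ?N"
      have "compose (carrier X) \<phi> (s \<oplus>\<^bsub>operators X X\<^esub> t) =
        compose (carrier X) \<phi> s \<oplus>\<^bsub>operators X ?C\<^esub> compose (carrier X) \<phi> t"
        using s t by (auto simp: compose_def fun_eq_iff operators_add[OF \<phi>]
            operators_closed[of s X X] operators_closed[of t X X])
      then show "s \<oplus>\<^bsub>operators X X\<^esub> t \<in> ?N"
        using s t sub by (simp add: XC.subspace_iff del: operators_simps)
    qed blast
    then have "rel_comp \<X> one_qset \<X> (dagger F) F X X \<subseteq> ?N"
    proof (rule rel_comp_least[OF XC XC])
      fix Y s r assume "Y \<in> one_qset" and "s \<in> dagger F Y X" and "r \<in> F X Y"
      then have s: "s \<in> carrier (operators ?C X)" and rF: "r \<in> F X ?C"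
        and r: "r \<in> carrier (operators X ?C)"
        using dagger_closed[OF assms quantum_set_one_qset Fun_binary_relations[OF F]]
          binary_relations_closed[OF Fun_binary_relations[OF F]]
        by (auto simp: one_qset_def)
      \<comment> \<open>\<phi> s maps scalars to scalars, hence is multiplication by
        \<open>\<phi> (s 1)\<close>.\<close>
      have "compose (carrier X) \<phi> (compose (carrier X) s r) = \<phi> (s 1) \<odot>\<^bsub>operators X ?C\<^esub> r"
      proof -
        have "\<phi> (s (r x)) = \<phi> (s 1) * r x" if "x \<in> carrier X" for x
          using operators_scale[OF s, of 1 "r x"] operators_scale[OF \<phi>, of "s 1" "r x"]
            operators_closed[OF s, of 1] by (simp add: mult.commute)
        then show ?thesis by (auto simp: compose_def fun_eq_iff)
      qed
      then show "compose (carrier X) s r \<in> ?N"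
        using compose_operators[OF XC s r] rF sub by (simp add: XC.subspace_iff del: operators_simps)
    qed
    moreover have "identity_operator X \<in> rel_comp \<X> one_qset \<X> (dagger F) F X X"
      using F identity_operator_mem_id_rel[OF XC X] by (auto simp: Fun_def le_fun_def)
    ultimately have "compose (carrier X) \<phi> (identity_operator X) \<in> F X ?C" by blast
    moreover have "compose (carrier X) \<phi> (identity_operator X) = \<phi>"
      using \<phi> by (auto simp: operators_iff compose_def identity_operator_def extensional_def fun_eq_iff)
    ultimately show "\<phi> \<in> F X ?C" by simp
  qed
  moreover have "F X Y = {}" if "X \<notin> \<X> \<or> Y \<notin> one_qset" for X Y
    using F that by (auto simp: Fun_def binary_relations_def)
  ultimately show "F = block_rel \<X> one_qset (\<lambda>_ _. True)"
    by (auto simp: block_rel_def fun_eq_iff one_qset_def)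
qed

section \<open>Functions with values in points\<close>

lemma Fun_point_component:
  assumes "quantum_set \<X>" "quantum_set \<Y>" "F \<in> Fun \<X> \<Y>" "X \<in> \<X>" "Y \<in> \<Y>"
    and w: "w \<in> carrier Y" "w \<noteq> \<zero>\<^bsub>Y\<^esub>"
    and rank1: "\<And>z. z \<in> carrier X \<Longrightarrow> rank_one X Y w z \<in> F X Y"
  shows "one_dimensional Y" "F X Y = carrier (operators X Y)"
    and "\<And>Y'. \<lbrakk>Y' \<in> \<Y>; Y' \<noteq> Y\<rbrakk> \<Longrightarrow> F X Y' = {\<zero>\<^bsub>operators X Y'\<^esub>}"
proof -
  have HX: "nonzero_fd_hilbert X" and HY: "nonzero_fd_hilbert Y"
    using assms(1,2,4,5) by (auto intro: quantum_setD)
  interpret X: nonzero_fd_hilbert X by (fact HX)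
  interpret Y: nonzero_fd_hilbert Y by (fact HY)
  note XC = X.complex_space_axioms and YC = Y.complex_space_axioms
  note bin = Fun_binary_relations[OF assms(3)]
  \<comment> \<open>The adjoint of |w><z| is |z><w|, and r |z><w| = |r z><w| lies in F F^dagger
    \<le> I. Both the vanishing of the other components and the one-dimensionality of Y are read off
    from this.\<close>
  have key: "rank_one Y Y' (r z) w \<in> id_rel \<Y> Y Y'"
    if Y': "Y' \<in> \<Y>" and r: "r \<in> F X Y'" and z: "z \<in> carrier X" for Y' r z
  proof -
    have Y'C: "complex_space Y'" using assms(2) Y' by (rule quantum_set_complex_space)
    have r_op: "r \<in> carrier (operators X Y')" using bin r by (rule binary_relations_closed)
    have k: "rank_one Y X z w \<in> dagger F Y X"
      unfolding dagger_def using rank1[OF z] adjoint_rank_one[OF HX HY w(1) z] by (metis imageI)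
    have "compose (carrier Y) r (rank_one Y X z w) \<in> rel_comp \<Y> \<X> \<Y> F (dagger F) Y Y'"
      using k r r_op assms(4,5) Y' YC Y'C rank_one_operators[OF HY XC z w(1)]
      by (intro rel_comp_mem[of _ _ _ X]) auto
    then show ?thesis
      using assms(3) compose_rank_one[OF HY XC r_op z w(1)]
      by (auto simp: Fun_def le_fun_def dest: spec2)
  qed
  show "F X Y' = {\<zero>\<^bsub>operators X Y'\<^esub>}" if Y': "Y' \<in> \<Y>" "Y' \<noteq> Y" for Y'
  proof -
    have Y'C: "complex_space Y'" using assms(2) Y'(1) by (rule quantum_set_complex_space)
    interpret L: complex_space "operators X Y'" by (intro complex_space_operators XC Y'C)
    have "r = \<zero>\<^bsub>operators X Y'\<^esub>" if r: "r \<in> F X Y'" for r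
    proof (rule operators_ext)
      show r_op: "r \<in> carrier (operators X Y')" using bin r by (rule binary_relations_closed)
      fix x assume x: "x \<in> carrier X"
      have "rank_one Y Y' (r x) w = \<zero>\<^bsub>operators Y Y'\<^esub>"
        using key[OF Y'(1) r x] id_rel_distinct[OF YC Y'C, of \<Y>] Y'(2) by blast
      then have "r x = \<zero>\<^bsub>Y'\<^esub>"
        using rank_one_eq_zero[OF HY Y'C operators_closed[OF r_op x] w(1)] w(2) by blast
      then show "r x = \<zero>\<^bsub>operators X Y'\<^esub> x" using x by simp
    qed (rule L.M.zero_closed)
    moreover have "\<zero>\<^bsub>operators X Y'\<^esub> \<in> F X Y'"
      using Fun_subspace[OF assms(3,4) Y'(1)] by (simp add: L.subspace_iff del: operators_simps)
    ultimately show ?thesis by blast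
  qed
  have gen: "\<exists>c. y = c \<odot>\<^bsub>Y\<^esub> w" if y: "y \<in> carrier Y" for y
  proof -
    obtain z where z: "z \<in> carrier X" "z \<noteq> \<zero>\<^bsub>X\<^esub>" using X.exists_nonzero by blast
    \<comment> \<open>\<open>key\<close> is applied to r = |w><z| itself. Its value at z is <z, z>
      w, so <z, z> |w><w| is a scalar operator c, and c is nonzero because this operator does not
      kill w. Dividing by c exhibits every y as a multiple of w.\<close>
    let ?k = "inner X z z"
    have k: "?k \<noteq> 0" using z by simp
    have "rank_one X Y w z z = ?k \<odot>\<^bsub>Y\<^esub> w" using z by (simp add: rank_one_def)
    then have "rank_one Y Y (?k \<odot>\<^bsub>Y\<^esub> w) w \<in> id_rel \<Y> Y Y"
      using key[OF assms(5) rank1[OF z(1)] z(1)] by simp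
    then obtain c where c: "\<And>v. v \<in> carrier Y \<Longrightarrow> rank_one Y Y (?k \<odot>\<^bsub>Y\<^esub> w) w v = c \<odot>\<^bsub>Y\<^esub> v"
      using id_rel_selfD[OF YC] by blast
    then have c': "(inner Y w v * ?k) \<odot>\<^bsub>Y\<^esub> w = c \<odot>\<^bsub>Y\<^esub> v" if "v \<in> carrier Y" for v
      using that w by (simp add: rank_one_def Y.scale_scale)
    have "c \<noteq> 0"
    proof
      assume "c = 0"
      then have "(inner Y w w * ?k) \<odot>\<^bsub>Y\<^esub> w = \<zero>\<^bsub>Y\<^esub>" using c'[OF w(1)] w by simp
      then show False using k w by (auto simp: Y.scale_eq_zero_iff)
    qed
    then have "y = inverse c \<odot>\<^bsub>Y\<^esub> (c \<odot>\<^bsub>Y\<^esub> y)" using y by (simp add: Y.scale_scale)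
    also have "\<dots> = (inverse c * (inner Y w y * ?k)) \<odot>\<^bsub>Y\<^esub> w"
      using w c'[OF y, symmetric] by (simp add: Y.scale_scale)
    finally show ?thesis by blast
  qed
  then show "one_dimensional Y" using w(1) by (auto simp: one_dimensional_def)
  note sub = Fun_subspace[OF assms(3-5)]
  show "F X Y = carrier (operators X Y)"
  proof (rule subspace_contains_rank_one[OF HX YC sub])
    interpret L: complex_space "operators X Y" by (intro complex_space_operators XC YC)
    fix v z assume v: "v \<in> carrier Y" and z: "z \<in> carrier X"
    obtain c where "v = c \<odot>\<^bsub>Y\<^esub> w" using gen[OF v] by blast
    then have "rank_one X Y v z = c \<odot>\<^bsub>operators X Y\<^esub> rank_one X Y w z"
      using w by (auto simp: rank_one_def fun_eq_iff Y.scale_scale mult.commute)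
    then show "rank_one X Y v z \<in> F X Y"
      using sub rank1[OF z] by (simp add: L.subspace_iff del: operators_simps)
  qed
qed

text \<open>The common hypothesis under which \<open>Fun_point_component\<close> applies at every
  atom. It holds for classical functions and for all functions out of \<open>one_qset\<close>, which
  are therefore treated together.\<close>

definition point_valued :: "'a qset \<Rightarrow> 'b qset \<Rightarrow> ('a, 'b) qrel \<Rightarrow> bool" where
  "point_valued \<X> \<Y> F \<longleftrightarrow> (\<forall>X\<in>\<X>. \<exists>Y\<in>\<Y>. \<exists>w\<in>carrier Y. w \<noteq> \<zero>\<^bsub>Y\<^esub> \<and>
    (\<forall>z\<in>carrier X. rank_one X Y w z \<in> F X Y))"

lemma Fun_point_valued:
  assumes "quantum_set \<X>" "quantum_set \<Y>" "F \<in> Fun \<X> \<Y>" "point_valued \<X> \<Y> F"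
  shows "\<exists>g. (\<forall>X\<in>\<X>. g X \<in> \<Y> \<and> one_dimensional (g X)) \<and> F = block_rel \<X> \<Y> (\<lambda>X Y. Y = g X)"
proof -
  obtain g w where g: "\<And>X. X \<in> \<X> \<Longrightarrow> g X \<in> \<Y>"
    "\<And>X. X \<in> \<X> \<Longrightarrow> w X \<in> carrier (g X)" "\<And>X. X \<in> \<X> \<Longrightarrow> w X \<noteq> \<zero>\<^bsub>g X\<^esub>"
    "\<And>X z. \<lbrakk>X \<in> \<X>; z \<in> carrier X\<rbrakk> \<Longrightarrow> rank_one X (g X) (w X) z \<in> F X (g X)"
    using assms(4) unfolding point_valued_def by metis
  note comp = Fun_point_component[OF assms(1-3) _ g(1) g(2) g(3) g(4)]
  have "F X Y = block_rel \<X> \<Y> (\<lambda>X Y. Y = g X) X Y" for X Y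
  proof (cases "X \<in> \<X> \<and> Y \<in> \<Y>")
    case True
    then show ?thesis using comp(2)[of X] comp(3)[of X Y] by (auto simp: block_rel_def simp del: operators_simps)
  next
    case False
    then show ?thesis using Fun_binary_relations[OF assms(3)]
      by (auto simp: block_rel_def binary_relations_def)
  qed
  then have "F = block_rel \<X> \<Y> (\<lambda>X Y. Y = g X)" by blast
  then show ?thesis using g(1) comp(1) by blast
qed

text \<open>A nonzero r : C \<rightarrow> Y is already of rank one, with w = r 1, and |r 1><z| is
  the multiple \<open>cnj z\<close> of r.\<close>

lemma point_valued_one_qset:
  assumes "quantum_set \<Y>" "G \<in> Fun one_qset \<Y>"
  shows "point_valued one_qset \<Y> G"
  unfolding point_valued_def
proof
  fix X assume X: "X \<in> one_qset"
  then have X_eq: "X = scalar_space" by (simp add: one_qset_def)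
  obtain Y r where Y: "Y \<in> \<Y>" and r: "r \<in> G X Y" "r \<noteq> \<zero>\<^bsub>operators X Y\<^esub>"
    using Fun_nonzero[OF quantum_set_one_qset assms X] by blast
  interpret Y: nonzero_fd_hilbert Y using assms(1) Y by (rule quantum_setD)
  interpret C: nonzero_fd_hilbert scalar_space by (rule nonzero_fd_hilbert_scalar_space)
  interpret L: complex_space "operators X Y"
    unfolding X_eq by (intro complex_space_operators C.complex_space_axioms Y.complex_space_axioms)
  have r_op: "r \<in> carrier (operators scalar_space Y)"
    using binary_relations_closed(3)[OF Fun_binary_relations[OF assms(2)] r(1)] X_eq by simp
  have r_eq: "r c = c \<odot>\<^bsub>Y\<^esub> r 1" for c using operators_scale[OF r_op, of 1 c] by simp
  have r1: "r 1 \<in> carrier Y" using operators_closed[OF r_op] by simp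
  have "r 1 \<noteq> \<zero>\<^bsub>Y\<^esub>"
  proof
    assume "r 1 = \<zero>\<^bsub>Y\<^esub>"
    then have "r c = \<zero>\<^bsub>Y\<^esub>" for c using r_eq[of c] by simp
    then show False using r(2) X_eq by (auto simp: fun_eq_iff)
  qed
  moreover have "rank_one X Y (r 1) z \<in> G X Y" for z
  proof -
    have "rank_one X Y (r 1) z = cnj z \<odot>\<^bsub>operators X Y\<^esub> r"
    proof
      fix c
      show "rank_one X Y (r 1) z c = (cnj z \<odot>\<^bsub>operators X Y\<^esub> r) c"
        using r1 by (simp add: X_eq rank_one_def r_eq[of c] Y.scale_scale)
    qed
    then show ?thesis
      using Fun_subspace[OF assms(2) X Y] r(1) by (simp add: L.subspace_iff del: operators_simps)
  qed
  ultimately show "\<exists>Y\<in>\<Y>. \<exists>w\<in>carrier Y. w \<noteq> \<zero>\<^bsub>Y\<^esub> \<and> (\<forall>z\<in>carrier X. rank_one X Y w z \<in> G X Y)"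
    using Y r1 by blast
qed

section \<open>Slices of tensors by the projections\<close>

lemma qset_prod_mem: "\<lbrakk>X \<in> \<X>; Y \<in> \<Y>\<rbrakk> \<Longrightarrow> tensor_space X Y \<in> qset_prod \<X> \<Y>"
  by (auto simp: qset_prod_def)

lemma qset_prod_complex_space: "A \<in> qset_prod \<X> \<Y> \<Longrightarrow> complex_space A"
  by (auto simp: qset_prod_def complex_space_tensor_space)

lemma rel_prod_mem:
  assumes "quantum_set \<X>1" "quantum_set \<X>2" "quantum_set \<Y>1" "quantum_set \<Y>2"
    and "X1 \<in> \<X>1" "X2 \<in> \<X>2" "Y1 \<in> \<Y>1" "Y2 \<in> \<Y>2"
    and "r1 \<in> R1 X1 Y1" "r2 \<in> R2 X2 Y2"
    and "r1 \<in> carrier (operators X1 Y1)" "r2 \<in> carrier (operators X2 Y2)"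
  shows "tensor_op X1 X2 Y1 Y2 r1 r2 \<in>
    rel_prod \<X>1 \<X>2 \<Y>1 \<Y>2 R1 R2 (tensor_space X1 X2) (tensor_space Y1 Y2)"
  unfolding rel_prod_def
proof (rule span_rel_mem)
  show "tensor_op X1 X2 Y1 Y2 r1 r2 \<in> carrier (operators (tensor_space X1 X2) (tensor_space Y1 Y2))"
    by (rule tensor_op_operators[OF quantum_setD[OF assms(1,5)] quantum_setD[OF assms(2,6)]
          quantum_setD[OF assms(3,7)] quantum_setD[OF assms(4,8)] assms(11,12)])
qed (use assms(5-10) in \<open>blast intro: complex_space_tensor_space qset_prod_mem\<close>)+

lemma rel_prod_closed:
  assumes "quantum_set \<X>1" "quantum_set \<X>2" "quantum_set \<Y>1" "quantum_set \<Y>2"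
    and "complex_space A" "complex_space B"
    and "\<And>X Y. \<lbrakk>X \<in> \<X>1; Y \<in> \<Y>1\<rbrakk> \<Longrightarrow> R1 X Y \<subseteq> carrier (operators X Y)"
    and "\<And>X Y. \<lbrakk>X \<in> \<X>2; Y \<in> \<Y>2\<rbrakk> \<Longrightarrow> R2 X Y \<subseteq> carrier (operators X Y)"
  shows "rel_prod \<X>1 \<X>2 \<Y>1 \<Y>2 R1 R2 A B \<subseteq> carrier (operators A B)"
  unfolding rel_prod_def
proof (rule span_rel_closed[OF assms(5,6)], safe)
  fix X1 X2 Y1 Y2 r1 r2
  assume "X1 \<in> \<X>1" "X2 \<in> \<X>2" "Y1 \<in> \<Y>1" "Y2 \<in> \<Y>2" "r1 \<in> R1 X1 Y1" "r2 \<in> R2 X2 Y2"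
  then show "tensor_op X1 X2 Y1 Y2 r1 r2
      \<in> carrier (operators (tensor_space X1 X2) (tensor_space Y1 Y2))"
    using assms(7)[of X1 Y1] assms(8)[of X2 Y2]
    by (intro tensor_op_operators quantum_setD[OF assms(1)] quantum_setD[OF assms(2)]
          quantum_setD[OF assms(3)] quantum_setD[OF assms(4)]) auto
qed

lemma left_unitor_closed:
  assumes "quantum_set \<Y>" "complex_space A" "Y \<in> \<Y>"
  shows "left_unitor \<Y> A Y \<subseteq> carrier (operators A Y)"
  unfolding left_unitor_def
  using assms(2) quantum_set_complex_space[OF assms(1,3)]
    left_unit_op_operators[OF quantum_setD[OF assms(1,3)]]
  by (intro span_rel_closed) auto

text \<open>Supplies the hypothesis of \<open>rel_comp_zero\<close> when \<open>proj2\<close> is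
  composed with a relation that is assumed to vanish.\<close>

lemma proj2_closed:
  assumes "quantum_set \<Y>1" "quantum_set \<Y>2" "A \<in> qset_prod \<Y>1 \<Y>2" "Y \<in> \<Y>2"
  shows "proj2 \<Y>1 \<Y>2 A Y \<subseteq> carrier (operators A Y)"
  unfolding proj2_def
proof (rule rel_comp_closed)
  note C = qset_prod_complex_space
  show "complex_space A" using assms(3) by (rule C)
  show "complex_space Y" using assms(2,4) by (rule quantum_set_complex_space)
  fix B assume B: "B \<in> qset_prod one_qset \<Y>2"
  show "left_unitor \<Y>2 B Y \<subseteq> carrier (operators B Y)"
    using assms(2) C[OF B] assms(4) by (rule left_unitor_closed)
  show "rel_prod \<Y>1 \<Y>2 one_qset \<Y>2 (terminal_map \<Y>1) (id_rel \<Y>2) A B \<subseteq> carrier (operators A B)"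
    using assms quantum_set_one_qset C[OF assms(3)] C[OF B]
    by (intro rel_prod_closed block_rel_closed id_rel_closed)
      (auto simp: terminal_map_eq intro!: subsetD[OF block_rel_closed] subsetD[OF id_rel_closed]
        quantum_set_complex_space)
qed

text \<open>Since the adjoint of the functional <z| takes 1 to z, tensoring with <z| turns the
  evaluation at 1 done by a unit operator into evaluation at z.\<close>

lemma functional_adjoint:
  assumes "nonzero_fd_hilbert X" "z \<in> carrier X"
  shows "rank_one X scalar_space 1 z \<in> carrier (operators X scalar_space)"
    and "adjoint X scalar_space (rank_one X scalar_space 1 z) 1 = z"
proof -
  interpret X: nonzero_fd_hilbert X by fact
  interpret C: nonzero_fd_hilbert scalar_space by (rule nonzero_fd_hilbert_scalar_space)
  show "rank_one X scalar_space 1 z \<in> carrier (operators X scalar_space)"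
    using assms C.complex_space_axioms by (intro rank_one_operators) auto
  show "adjoint X scalar_space (rank_one X scalar_space 1 z) 1 = z"
    using adjoint_rank_one[OF assms(1) nonzero_fd_hilbert_scalar_space _ assms(2), of 1] assms(2)
    by (simp add: rank_one_def)
qed

lemma adjoint_identity_operator:
  assumes "nonzero_fd_hilbert X"
  shows "adjoint X X (identity_operator X) = identity_operator X"
  using assms
  by (intro adjoint_eqI identity_operator_operators nonzero_fd_hilbert_complex_space)
    (auto simp: identity_operator_def)

text \<open>The witness is 1 \<otimes> <z| followed by the unit operator. It belongs to
  \<open>proj1\<close> for every z because the function to \<open>one_qset\<close> is full; it is
  the partial inner product with z in the second factor.\<close>

lemma proj1_slice:
  assumes "quantum_set \<Y>1" "quantum_set \<Y>2" "Y1 \<in> \<Y>1" "Y2 \<in> \<Y>2" "z \<in> carrier Y2"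
  shows "\<exists>p\<in>proj1 \<Y>1 \<Y>2 (tensor_space Y1 Y2) Y1. p \<in> carrier (operators (tensor_space Y1 Y2) Y1) \<and>
    (\<forall>T\<in>carrier (tensor_space Y1 Y2). \<forall>u\<in>carrier Y1. inner Y1 u (p T) = snd T u z)"
proof -
  let ?C = "scalar_space"
  let ?A = "tensor_space Y1 Y2" and ?B = "tensor_space Y1 ?C"
  have H: "nonzero_fd_hilbert Y1" "nonzero_fd_hilbert Y2" "nonzero_fd_hilbert ?C"
    using assms nonzero_fd_hilbert_scalar_space by (auto intro: quantum_setD)
  note C = H[THEN nonzero_fd_hilbert_complex_space]
  have one: "?C \<in> one_qset" by (simp add: one_qset_def)
  define \<phi> where "\<phi> = rank_one Y2 ?C 1 z"
  have \<phi>: "\<phi> \<in> carrier (operators Y2 ?C)" and \<phi>_adj: "adjoint Y2 ?C \<phi> 1 = z"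
    unfolding \<phi>_def using functional_adjoint[OF H(2) assms(5)] by auto
  note id = identity_operator_operators[OF C(1)]
  let ?t = "tensor_op Y1 Y2 Y1 ?C (identity_operator Y1) \<phi>"
  have t: "?t \<in> carrier (operators ?A ?B)" by (rule tensor_op_operators[OF H(1,2,1,3) id \<phi>])
  have u: "right_unit_op Y1 \<in> carrier (operators ?B Y1)" by (rule right_unit_op_operators[OF H(1)])
  let ?p = "compose (carrier ?A) (right_unit_op Y1) ?t"
  have "?t \<in> rel_prod \<Y>1 \<Y>2 \<Y>1 one_qset (id_rel \<Y>1) (terminal_map \<Y>2) ?A ?B"
    using assms quantum_set_one_qset one id \<phi> identity_operator_mem_id_rel[OF C(1) assms(3)]
    by (intro rel_prod_mem) (auto simp: terminal_map_eq block_rel_def)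
  moreover have "right_unit_op Y1 \<in> right_unitor \<Y>1 ?B Y1"
    unfolding right_unitor_def using assms one u C complex_space_tensor_space
    by (intro span_rel_mem qset_prod_mem) auto
  ultimately have "?p \<in> proj1 \<Y>1 \<Y>2 ?A Y1"
    unfolding proj1_def using assms one u t C complex_space_tensor_space
    by (intro rel_comp_mem[of _ _ _ ?B] qset_prod_mem) auto
  moreover have "?p \<in> carrier (operators ?A Y1)"
    by (rule compose_operators[OF complex_space_tensor_space u t])
  moreover have "inner Y1 v (?p T) = snd T v z" if "T \<in> carrier ?A" "v \<in> carrier Y1" for T v
  proof -
    have "inner Y1 v (?p T) = snd (?t T) v 1"
      using that inner_right_unit_op[OF H(1) operators_closed[OF t that(1)] that(2)]
      by (simp add: compose_def del: tensor_space_simps)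
    also have "\<dots> = snd T v z"
      using snd_tensor_op[OF H(1,2,1,3) id \<phi> that, of 1] that(2)
      by (simp add: adjoint_identity_operator[OF H(1)] \<phi>_adj) (simp add: identity_operator_def)
    finally show ?thesis .
  qed
  ultimately show ?thesis by blast
qed

lemma proj2_slice:
  assumes "quantum_set \<Y>1" "quantum_set \<Y>2" "Y1 \<in> \<Y>1" "Y2 \<in> \<Y>2" "z \<in> carrier Y1"
  shows "\<exists>p\<in>proj2 \<Y>1 \<Y>2 (tensor_space Y1 Y2) Y2. p \<in> carrier (operators (tensor_space Y1 Y2) Y2) \<and>
    (\<forall>T\<in>carrier (tensor_space Y1 Y2). \<forall>u\<in>carrier Y2. inner Y2 u (p T) = snd T z u)"
proof -
  let ?C = "scalar_space"
  let ?A = "tensor_space Y1 Y2" and ?B = "tensor_space ?C Y2"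
  have H: "nonzero_fd_hilbert Y1" "nonzero_fd_hilbert Y2" "nonzero_fd_hilbert ?C"
    using assms nonzero_fd_hilbert_scalar_space by (auto intro: quantum_setD)
  note C = H[THEN nonzero_fd_hilbert_complex_space]
  have one: "?C \<in> one_qset" by (simp add: one_qset_def)
  define \<phi> where "\<phi> = rank_one Y1 ?C 1 z"
  have \<phi>: "\<phi> \<in> carrier (operators Y1 ?C)" and \<phi>_adj: "adjoint Y1 ?C \<phi> 1 = z"
    unfolding \<phi>_def using functional_adjoint[OF H(1) assms(5)] by auto
  note id = identity_operator_operators[OF C(2)]
  let ?t = "tensor_op Y1 Y2 ?C Y2 \<phi> (identity_operator Y2)"
  have t: "?t \<in> carrier (operators ?A ?B)" by (rule tensor_op_operators[OF H(1,2,3,2) \<phi> id])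
  have u: "left_unit_op Y2 \<in> carrier (operators ?B Y2)" by (rule left_unit_op_operators[OF H(2)])
  let ?p = "compose (carrier ?A) (left_unit_op Y2) ?t"
  have "?t \<in> rel_prod \<Y>1 \<Y>2 one_qset \<Y>2 (terminal_map \<Y>1) (id_rel \<Y>2) ?A ?B"
    using assms quantum_set_one_qset one id \<phi> identity_operator_mem_id_rel[OF C(2) assms(4)]
    by (intro rel_prod_mem) (auto simp: terminal_map_eq block_rel_def)
  moreover have "left_unit_op Y2 \<in> left_unitor \<Y>2 ?B Y2"
    unfolding left_unitor_def using assms one u C complex_space_tensor_space
    by (intro span_rel_mem qset_prod_mem) auto
  ultimately have "?p \<in> proj2 \<Y>1 \<Y>2 ?A Y2"
    unfolding proj2_def using assms one u t C complex_space_tensor_space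
    by (intro rel_comp_mem[of _ _ _ ?B] qset_prod_mem) auto
  moreover have "?p \<in> carrier (operators ?A Y2)"
    by (rule compose_operators[OF complex_space_tensor_space u t])
  moreover have "inner Y2 v (?p T) = snd T z v" if "T \<in> carrier ?A" "v \<in> carrier Y2" for T v
  proof -
    have "inner Y2 v (?p T) = snd (?t T) 1 v"
      using that inner_left_unit_op[OF H(2) operators_closed[OF t that(1)] that(2)]
      by (simp add: compose_def del: tensor_space_simps)
    also have "\<dots> = snd T z v"
      using snd_tensor_op[OF H(1,2,3,2) \<phi> id that(1) _ that(2), of 1] that(2)
      by (simp add: adjoint_identity_operator[OF H(2)] \<phi>_adj) (simp add: identity_operator_def)
    finally show ?thesis .
  qed
  ultimately show ?thesis by blast
qed

lemma classical_point_valued: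
  assumes "quantum_set \<X>" "quantum_set \<Y>" "F \<in> classical_Fun \<X> \<Y>"
  shows "point_valued \<X> \<Y> F"
  unfolding point_valued_def
proof
  fix X assume X: "X \<in> \<X>"
  let ?P = "qset_prod \<Y> \<X>"
  obtain K where K: "K \<in> Fun \<X> ?P" and K1: "rel_comp \<X> ?P \<Y> (proj1 \<Y> \<X>) K = F"
    and K2: "rel_comp \<X> ?P \<X> (proj2 \<Y> \<X>) K = id_rel \<X>"
    using assms(3) by (auto simp: classical_Fun_def compatible_def)
  note K_closed = binary_relations_closed[OF Fun_binary_relations[OF K]]
  interpret X: nonzero_fd_hilbert X using assms(1) X by (rule quantum_setD)
  note XC = X.complex_space_axioms
  \<comment> \<open>Nonvanishing is read off from P2 K = I, which contains 1_X.
    \<open>Fun_nonzero\<close> would first require the Hilbert space axioms for the tensor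
    products.\<close>
  have "\<exists>A\<in>?P. \<exists>h\<in>K X A. h \<noteq> \<zero>\<^bsub>operators X A\<^esub>"
  proof (rule ccontr)
    assume "\<not> ?thesis"
    then have "K X A \<subseteq> {\<zero>\<^bsub>operators X A\<^esub>}" if "A \<in> ?P" for A using that by blast
    then have "rel_comp \<X> ?P \<X> (proj2 \<Y> \<X>) K X X \<subseteq> {\<zero>\<^bsub>operators X X\<^esub>}"
      using assms X XC by (intro rel_comp_zero proj2_closed qset_prod_complex_space)
    then have "identity_operator X = \<zero>\<^bsub>operators X X\<^esub>"
      using K2 identity_operator_mem_id_rel[OF XC X] by auto
    then show False using identity_operator_nonzero[OF X.nonzero_fd_hilbert_axioms] by blast
  qed
  then obtain Y X' h where Y: "Y \<in> \<Y>" and X': "X' \<in> \<X>"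
    and h: "h \<in> K X (tensor_space Y X')" "h \<noteq> \<zero>\<^bsub>operators X (tensor_space Y X')\<^esub>"
    by (auto simp: qset_prod_def simp del: operators_simps)
  let ?A = "tensor_space Y X'"
  interpret Y: nonzero_fd_hilbert Y using assms(2) Y by (rule quantum_setD)
  interpret X': nonzero_fd_hilbert X' using assms(1) X' by (rule quantum_setD)
  interpret A: complex_space ?A by (rule complex_space_tensor_space)
  interpret L: complex_space "operators X ?A" by (intro complex_space_operators XC A.complex_space_axioms)
  have A: "?A \<in> ?P" using Y X' by (rule qset_prod_mem)
  have h_op: "h \<in> carrier (operators X ?A)" by (rule K_closed(3)[OF h(1)])
  have h_nz: "\<exists>x\<in>carrier X. \<exists>y\<in>carrier Y. \<exists>u\<in>carrier X'. snd (h x) y u \<noteq> 0"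
  proof (rule ccontr)
    assume *: "\<not> ?thesis"
    have "h = \<zero>\<^bsub>operators X ?A\<^esub>"
    proof (rule operators_ext[OF h_op L.M.zero_closed])
      fix x assume x: "x \<in> carrier X"
      have "h x = \<zero>\<^bsub>?A\<^esub>"
        using * x by (intro tensor_space_ext[OF operators_closed[OF h_op x] A.M.zero_closed]) auto
      then show "h x = \<zero>\<^bsub>operators X ?A\<^esub> x" using x by simp
    qed
    then show False using h(2) by contradiction
  qed
  \<comment> \<open>Slicing in direction y yields an element of P2 K = I, and the slices in all
    directions together determine h. Off the diagonal they would all be zero; on the diagonal each
    is a scalar, named \<open>c y\<close> below.\<close>
  have q: "\<exists>q. compose (carrier X) q h \<in> id_rel \<X> X X' \<and>
      (\<forall>x\<in>carrier X. q (h x) \<in> carrier X' \<and> (\<forall>u\<in>carrier X'. inner X' u (q (h x)) = snd (h x) y u))"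
    if y: "y \<in> carrier Y" for y
  proof -
    obtain q where q: "q \<in> proj2 \<Y> \<X> ?A X'" "q \<in> carrier (operators ?A X')"
      "\<And>T u. \<lbrakk>T \<in> carrier ?A; u \<in> carrier X'\<rbrakk> \<Longrightarrow> inner X' u (q T) = snd T y u"
      using proj2_slice[OF assms(2,1) Y X' y] by blast
    have "compose (carrier X) q h \<in> rel_comp \<X> ?P \<X> (proj2 \<Y> \<X>) K X X'"
      using XC X'.complex_space_axioms X X' A q h h_op by (intro rel_comp_mem[of _ _ _ ?A]) auto
    then show ?thesis
      using q(3) operators_closed[OF h_op] operators_closed[OF q(2)] unfolding K2 by blast
  qed
  have X'_eq: "X' = X"
  proof (rule ccontr)
    assume ne: "X' \<noteq> X"
    have "snd (h x) y u = 0" if xyu: "x \<in> carrier X" "y \<in> carrier Y" "u \<in> carrier X'" for x y u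
    proof -
      obtain q where q: "compose (carrier X) q h \<in> id_rel \<X> X X'"
        "inner X' u (q (h x)) = snd (h x) y u"
        using q[OF xyu(2)] xyu by blast
      then have "compose (carrier X) q h = \<zero>\<^bsub>operators X X'\<^esub>"
        using id_rel_distinct[OF XC X'.complex_space_axioms, of \<X>] ne by auto
      then have "compose (carrier X) q h x = \<zero>\<^bsub>operators X X'\<^esub> x" by (rule fun_cong)
      then have "q (h x) = \<zero>\<^bsub>X'\<^esub>" using xyu(1) by (simp add: compose_def)
      then show ?thesis using q(2) xyu by simp
    qed
    then show False using h_nz by blast
  qed
  have "\<exists>c. \<forall>x\<in>carrier X. \<forall>u\<in>carrier X. snd (h x) y u = c * inner X u x" if y: "y \<in> carrier Y" for y
  proof -
    obtain q where q: "compose (carrier X) q h \<in> id_rel \<X> X X"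
      "\<And>x u. \<lbrakk>x \<in> carrier X; u \<in> carrier X\<rbrakk> \<Longrightarrow> inner X u (q (h x)) = snd (h x) y u"
      using q[OF y] unfolding X'_eq by blast
    obtain c where "\<forall>x\<in>carrier X. compose (carrier X) q h x = c \<odot>\<^bsub>X\<^esub> x"
      using id_rel_selfD[OF XC q(1)] by blast
    then have "inner X u (q (h x)) = c * inner X u x" if "x \<in> carrier X" "u \<in> carrier X" for x u
      using that by (auto simp: compose_def X.inner_smult)
    then show ?thesis using q(2) by auto
  qed
  then obtain c where c: "\<And>y x u. \<lbrakk>y \<in> carrier Y; x \<in> carrier X; u \<in> carrier X\<rbrakk> \<Longrightarrow>
      snd (h x) y u = c y * inner X u x"
    by metis
  \<comment> \<open>Evaluating at one fixed nonzero e expresses c through the single form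
    \<open>h e\<close>. Thus c inherits conjugate-linearity, and w is its Riesz vector.\<close>
  obtain e where e: "e \<in> carrier X" "e \<noteq> \<zero>\<^bsub>X\<^esub>" using X.exists_nonzero by blast
  have c_eq: "c y = snd (h e) y e / inner X e e" if "y \<in> carrier Y" for y
    using c[OF that e(1,1)] e by simp
  have he: "h e \<in> carrier (tensor_space Y X)"
    using operators_closed[OF h_op e(1)] X'_eq by simp
  have "\<exists>w\<in>carrier Y. \<forall>y\<in>carrier Y. inner Y y w = c y"
    using tensor_spaceD[OF he] e
    by (intro Y.riesz) (auto simp: c_eq add_divide_distrib)
  then obtain w where w: "w \<in> carrier Y" "\<And>y. y \<in> carrier Y \<Longrightarrow> inner Y y w = c y" by blast
  have "w \<noteq> \<zero>\<^bsub>Y\<^esub>"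
  proof
    assume "w = \<zero>\<^bsub>Y\<^esub>"
    then have "c y = 0" if "y \<in> carrier Y" for y using w(2)[OF that] that by simp
    then show False using h_nz c X'_eq by auto
  qed
  moreover have "rank_one X Y w z \<in> F X Y" if z: "z \<in> carrier X" for z
  proof -
    obtain p where p: "p \<in> proj1 \<Y> \<X> ?A Y" "p \<in> carrier (operators ?A Y)"
      "\<And>T u. \<lbrakk>T \<in> carrier ?A; u \<in> carrier Y\<rbrakk> \<Longrightarrow> inner Y u (p T) = snd T u z"
      using proj1_slice[OF assms(2,1) Y X'] z X'_eq by blast
    have "compose (carrier X) p h \<in> rel_comp \<X> ?P \<Y> (proj1 \<Y> \<X>) K X Y"
      using XC Y.complex_space_axioms X Y A p h h_op by (intro rel_comp_mem[of _ _ _ ?A]) auto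
    \<comment> \<open>Slicing the second factor by z turns h x = w \<otimes> x into <z, x>
      w.\<close>
    moreover have "compose (carrier X) p h = rank_one X Y w z"
    proof (rule operators_ext)
      show "compose (carrier X) p h \<in> carrier (operators X Y)"
        using XC p(2) h_op by (rule compose_operators)
      show "rank_one X Y w z \<in> carrier (operators X Y)"
        by (rule rank_one_operators[OF X.nonzero_fd_hilbert_axioms Y.complex_space_axioms w(1) z])
      fix x assume x: "x \<in> carrier X"
      show "compose (carrier X) p h x = rank_one X Y w z x"
      proof (rule Y.inner_ext)
        show "compose (carrier X) p h x \<in> carrier Y"
          using x operators_closed[OF p(2) operators_closed[OF h_op x]] by (simp add: compose_def)
        show "rank_one X Y w z x \<in> carrier Y" using x w by (simp add: rank_one_def)
        fix u assume u: "u \<in> carrier Y"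
        show "inner Y u (compose (carrier X) p h x) = inner Y u (rank_one X Y w z x)"
          using x u w z c[OF u x z] p(3)[OF operators_closed[OF h_op x] u]
          by (simp add: compose_def rank_one_def Y.inner_smult)
      qed
    qed
    ultimately show ?thesis using K1 by simp
  qed
  ultimately show "\<exists>Y\<in>\<Y>. \<exists>w\<in>carrier Y. w \<noteq> \<zero>\<^bsub>Y\<^esub> \<and> (\<forall>z\<in>carrier X. rank_one X Y w z \<in> F X Y)"
    using Y w(1) by blast
qed

section \<open>Points of \<Y> and the factorization through J and Q\<close>

lemma point_atom_block_rel:
  assumes "quantum_set \<Y>" "Y \<in> \<Y>"
  shows "point_atom \<Y> (block_rel one_qset \<Y> (\<lambda>_ Z. Z = Y)) = Y"
  unfolding point_atom_def
  using assms operators_nonzero[OF nonzero_fd_hilbert_scalar_space quantum_setD[OF assms]]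
  by (intro the_equality) (auto simp: block_rel_def one_qset_def simp del: operators_simps split: if_splits)

text \<open>Functions out of \<open>one_qset\<close> are point-valued, so a point is full at one
  atom and zero elsewhere. It can therefore be recovered from its atom, which is the injectivity of
  G \<mapsto> Y_G.\<close>

lemma Fun_one_qset_eq:
  assumes "quantum_set \<Y>" "G \<in> Fun one_qset \<Y>"
  shows "G = block_rel one_qset \<Y> (\<lambda>_ Y. Y = point_atom \<Y> G)"
proof -
  obtain g where g: "g scalar_space \<in> \<Y>" "G = block_rel one_qset \<Y> (\<lambda>X Y. Y = g X)"
    using Fun_point_valued[OF quantum_set_one_qset assms point_valued_one_qset[OF assms]]
    by (auto simp: one_qset_def)
  then have G: "G = block_rel one_qset \<Y> (\<lambda>_ Y. Y = g scalar_space)"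
    by (auto simp: one_qset_def intro!: block_rel_cong)
  then have "point_atom \<Y> G = g scalar_space"
    using point_atom_block_rel[OF assms(1) g(1)] by simp
  then show ?thesis using G by simp
qed

text \<open>All three factors are block relations, so composing them means composing predicates.
  Injectivity of \<open>point_space\<close> removes the intermediate atoms.\<close>

lemma classical_factorization:
  assumes "quantum_set \<X>" "quantum_set \<Y>" "f \<in> \<X> \<rightarrow> Fun one_qset \<Y>"
  shows "rel_comp \<X> (classical_qset (Fun one_qset \<Y>)) \<Y> (canonical_injection \<Y>)
      (rel_comp \<X> (classical_qset \<X>) (classical_qset (Fun one_qset \<Y>))
        (classical_map \<X> (Fun one_qset \<Y>) f) (canonical_surjection \<X>)) =
    block_rel \<X> \<Y> (\<lambda>X Y. Y = point_atom \<Y> (f X))"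
  unfolding canonical_injection_def canonical_surjection_def classical_map_def
proof (simp only: rel_comp_block_rel assms quantum_set_classical_qset, rule block_rel_cong)
  fix X Y assume XY: "X \<in> \<X>" "Y \<in> \<Y>"
  have fX: "f X \<in> Fun one_qset \<Y>" using assms(3) XY by blast
  show "(\<exists>A'\<in>classical_qset (Fun one_qset \<Y>).
      (\<exists>A\<in>classical_qset \<X>. A = point_space X \<and>
        (\<exists>a\<in>\<X>. A = point_space a \<and> A' = point_space (f a))) \<and>
      (\<exists>G\<in>Fun one_qset \<Y>. A' = point_space G \<and> Y = point_atom \<Y> G)) \<longleftrightarrow>
    Y = point_atom \<Y> (f X)" (is "?L \<longleftrightarrow> ?R")
  proof
    assume ?L
    then show ?R by (auto dest!: inj_point_space)
  next
    assume ?R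
    then show ?L
      using XY fX by (intro bexI[of _ "point_space (f X)"]) (auto simp: classical_qset_def)
  qed
qed

theorem proposition10p8:
  fixes \<X> :: "'a qset" and \<Y> :: "'b qset" and F :: "('a, 'b) qrel"
  assumes "quantum_set \<X>" and "quantum_set \<Y>"
    and "F \<in> classical_Fun \<X> \<Y>"
  shows "\<exists>!f. f \<in> \<X> \<rightarrow>\<^sub>E Fun one_qset \<Y> \<and>
    F = rel_comp \<X> (classical_qset (Fun one_qset \<Y>)) \<Y>
          (canonical_injection \<Y>)
          (rel_comp \<X> (classical_qset \<X>) (classical_qset (Fun one_qset \<Y>))
            (classical_map \<X> (Fun one_qset \<Y>) f)
            (canonical_surjection \<X>))"
proof -
  note factor = classical_factorization[OF assms(1,2)]
  have F: "F \<in> Fun \<X> \<Y>" using assms(3) by (simp add: classical_Fun_def)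
  obtain g where g: "\<And>X. X \<in> \<X> \<Longrightarrow> g X \<in> \<Y>" "\<And>X. X \<in> \<X> \<Longrightarrow> one_dimensional (g X)"
    and F_eq: "F = block_rel \<X> \<Y> (\<lambda>X Y. Y = g X)"
    using Fun_point_valued[OF assms(1,2) F classical_point_valued[OF assms]] by blast
  \<comment> \<open>The value at X is the point whose atom is g X. Restriction to \<X> fixes the
    values off \<X>, so that uniqueness can hold as an equality of functions.\<close>
  define f where "f = (\<lambda>X\<in>\<X>. block_rel one_qset \<Y> (\<lambda>_ Y. Y = g X))"
  have "block_rel one_qset \<Y> (\<lambda>_ Y. Y = g X) \<in> Fun one_qset \<Y>" if "X \<in> \<X>" for X
    using g that by (intro block_rel_Fun quantum_set_one_qset assms) auto
  then have f: "f \<in> \<X> \<rightarrow>\<^sub>E Fun one_qset \<Y>" by (auto simp: f_def)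
  have atom_f: "point_atom \<Y> (f X) = g X" if "X \<in> \<X>" for X
    using that point_atom_block_rel[OF assms(2) g(1)[OF that]] by (simp add: f_def)
  show ?thesis
  proof (rule ex1I[of _ f], intro conjI)
    show "f \<in> \<X> \<rightarrow>\<^sub>E Fun one_qset \<Y>" by fact
    have "F = block_rel \<X> \<Y> (\<lambda>X Y. Y = point_atom \<Y> (f X))"
      unfolding F_eq by (rule block_rel_cong) (simp add: atom_f)
    then show "F = rel_comp \<X> (classical_qset (Fun one_qset \<Y>)) \<Y> (canonical_injection \<Y>)
        (rel_comp \<X> (classical_qset \<X>) (classical_qset (Fun one_qset \<Y>))
          (classical_map \<X> (Fun one_qset \<Y>) f) (canonical_surjection \<X>))"
      using factor[of f] f by (simp add: PiE_def)
  next
    fix f' assume f': "f' \<in> \<X> \<rightarrow>\<^sub>E Fun one_qset \<Y> \<and>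
      F = rel_comp \<X> (classical_qset (Fun one_qset \<Y>)) \<Y> (canonical_injection \<Y>)
        (rel_comp \<X> (classical_qset \<X>) (classical_qset (Fun one_qset \<Y>))
          (classical_map \<X> (Fun one_qset \<Y>) f') (canonical_surjection \<X>))"
    then have eq: "block_rel \<X> \<Y> (\<lambda>X Y. Y = g X) = block_rel \<X> \<Y> (\<lambda>X Y. Y = point_atom \<Y> (f' X))"
      using factor[of f'] F_eq by (simp add: PiE_def)
    show "f' = f"
    proof (rule PiE_ext)
      show "f' \<in> \<X> \<rightarrow>\<^sub>E Fun one_qset \<Y>" using f' by blast
      show "f \<in> \<X> \<rightarrow>\<^sub>E Fun one_qset \<Y>" by fact
      fix X assume X: "X \<in> \<X>"
      \<comment> \<open>The two predicates are compared at the pair (X, g X). As f' X is a point,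
        its atom then determines it.\<close>
      have "point_atom \<Y> (f' X) = g X"
        using block_rel_eqD[OF assms(1,2) eq X g(1)[OF X]] by simp
      moreover have "f' X \<in> Fun one_qset \<Y>" using f' X by blast
      ultimately show "f' X = f X"
        using Fun_one_qset_eq[OF assms(2), of "f' X"] X by (simp add: f_def)
    qed
  qed
qed

end
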